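(* Let $u\le v$ be elements of a Coxeter group $W$. Every special matching $M$ of the Hasse diagram of $[u,v]$ is a graph automorphism of $\Gamma(u,v)$.
   Context: $(W,S)$ is a Coxeter system with reflections $T$ (conjugates of $S$), length $\ell$ and Bruhat order $\le$. $\Gamma(u,v)$ is the simple undirected graph on $[u,v]$ with edges $\{x,xt\}$, $t\in T$. The Hasse diagram of $[u,v]$ is the graph whose edges are the cover relations $x\lessdot y$. A perfect matching is a fixed-point-free involution $M$ of the vertex set with each $\{x,M(x)\}$ an edge; it is a special matching if for every cover $x\lessdot y$ in $[u,v]$, either $M(x)=y$ or $M(x)<M(y)$. *)

theory Defs
  imports "HOL-Algebra.Group"
begin

definition word_prod :: "('a, 'b) monoid_scheme \<Rightarrow> 'a list \<Rightarrow> 'a" where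
  "word_prod G ws = foldr (\<lambda>s acc. s \<otimes>\<^bsub>G\<^esub> acc) ws \<one>\<^bsub>G\<^esub>"

text \<open>Elementary relator deletion: remove a factor (s t)^n with (st)^n = 1 in G,
  s, t in S. (With t = s, n = 1 this is s s = 1.)\<close>
inductive coxeter_step :: "('a, 'b) monoid_scheme \<Rightarrow> 'a set \<Rightarrow> 'a list \<Rightarrow> 'a list \<Rightarrow> bool"
  for G S where
  "s \<in> S \<Longrightarrow> t \<in> S \<Longrightarrow> (s \<otimes>\<^bsub>G\<^esub> t) [^]\<^bsub>G\<^esub> (n::nat) = \<one>\<^bsub>G\<^esub> \<Longrightarrow>
     coxeter_step G S (xs @ concat (replicate n [s, t]) @ ys) (xs @ ys)"

text \<open>(G,S) is a Coxeter system: S is a generating set of involutions and the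
  relations (st)^{m(s,t)} = 1 (m(s,t) the order of st) present G, i.e. two words
  over S with equal product are equivalent modulo these relations.\<close>
definition coxeter_system :: "('a, 'b) monoid_scheme \<Rightarrow> 'a set \<Rightarrow> bool" where
  "coxeter_system G S \<longleftrightarrow>
     group G \<and> S \<subseteq> carrier G \<and> \<one>\<^bsub>G\<^esub> \<notin> S \<and>
     (\<forall>s\<in>S. s \<otimes>\<^bsub>G\<^esub> s = \<one>\<^bsub>G\<^esub>) \<and>
     (\<forall>w\<in>carrier G. \<exists>ws\<in>lists S. word_prod G ws = w) \<and>
     (\<forall>ws\<in>lists S. \<forall>ws'\<in>lists S. word_prod G ws = word_prod G ws' \<longrightarrow>
         equivclp (coxeter_step G S) ws ws')"

definition reflections :: "('a, 'b) monoid_scheme \<Rightarrow> 'a set \<Rightarrow> 'a set" where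
  "reflections G S = {w \<otimes>\<^bsub>G\<^esub> s \<otimes>\<^bsub>G\<^esub> inv\<^bsub>G\<^esub> w | w s. w \<in> carrier G \<and> s \<in> S}"

definition cox_length :: "('a, 'b) monoid_scheme \<Rightarrow> 'a set \<Rightarrow> 'a \<Rightarrow> nat" where
  "cox_length G S w = (LEAST n. \<exists>ws\<in>lists S. length ws = n \<and> word_prod G ws = w)"

definition bruhat_step :: "('a, 'b) monoid_scheme \<Rightarrow> 'a set \<Rightarrow> 'a \<Rightarrow> 'a \<Rightarrow> bool" where
  "bruhat_step G S x y \<longleftrightarrow> x \<in> carrier G \<and>
     (\<exists>t\<in>reflections G S. y = x \<otimes>\<^bsub>G\<^esub> t) \<and> cox_length G S x < cox_length G S y"

definition bruhat_le :: "('a, 'b) monoid_scheme \<Rightarrow> 'a set \<Rightarrow> 'a \<Rightarrow> 'a \<Rightarrow> bool" where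
  "bruhat_le G S x y \<longleftrightarrow> x \<in> carrier G \<and> (bruhat_step G S)\<^sup>*\<^sup>* x y"

definition bruhat_less :: "('a, 'b) monoid_scheme \<Rightarrow> 'a set \<Rightarrow> 'a \<Rightarrow> 'a \<Rightarrow> bool" where
  "bruhat_less G S x y \<longleftrightarrow> bruhat_le G S x y \<and> x \<noteq> y"

definition bruhat_cover :: "('a, 'b) monoid_scheme \<Rightarrow> 'a set \<Rightarrow> 'a \<Rightarrow> 'a \<Rightarrow> bool" where
  "bruhat_cover G S x y \<longleftrightarrow> bruhat_less G S x y \<and>
     \<not> (\<exists>z. bruhat_less G S x z \<and> bruhat_less G S z y)"

definition bruhat_interval :: "('a, 'b) monoid_scheme \<Rightarrow> 'a set \<Rightarrow> 'a \<Rightarrow> 'a \<Rightarrow> 'a set" where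
  "bruhat_interval G S u v = {x. bruhat_le G S u x \<and> bruhat_le G S x v}"

definition special_matching :: "('a, 'b) monoid_scheme \<Rightarrow> 'a set \<Rightarrow> 'a \<Rightarrow> 'a \<Rightarrow> ('a \<Rightarrow> 'a) \<Rightarrow> bool" where
  "special_matching G S u v M \<longleftrightarrow>
     (\<forall>x\<in>bruhat_interval G S u v.
        M x \<in> bruhat_interval G S u v \<and> M (M x) = x \<and> M x \<noteq> x \<and>
        (bruhat_cover G S x (M x) \<or> bruhat_cover G S (M x) x)) \<and>
     (\<forall>x\<in>bruhat_interval G S u v. \<forall>y\<in>bruhat_interval G S u v.
        bruhat_cover G S x y \<longrightarrow> M x = y \<or> bruhat_less G S (M x) (M y))"

definition gamma_adj :: "('a, 'b) monoid_scheme \<Rightarrow> 'a set \<Rightarrow> 'a \<Rightarrow> 'a \<Rightarrow> bool" where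
  "gamma_adj G S x y \<longleftrightarrow> (\<exists>t\<in>reflections G S. y = x \<otimes>\<^bsub>G\<^esub> t)"

definition gamma_automorphism :: "('a, 'b) monoid_scheme \<Rightarrow> 'a set \<Rightarrow> 'a \<Rightarrow> 'a \<Rightarrow> ('a \<Rightarrow> 'a) \<Rightarrow> bool" where
  "gamma_automorphism G S u v f \<longleftrightarrow>
     bij_betw f (bruhat_interval G S u v) (bruhat_interval G S u v) \<and>
     (\<forall>x\<in>bruhat_interval G S u v. \<forall>y\<in>bruhat_interval G S u v.
        gamma_adj G S x y \<longleftrightarrow> gamma_adj G S (f x) (f y))"

end

theory Submission
  imports Defs "HOL-Algebra.Multiplicative_Group"
begin

text \<open>
  Edges of the Bruhat graph are treated by induction on the difference of the lengths of their
  endpoints. If \<open>x \<rightarrow> y\<close> is an edge of length difference at least 3, some coset of a dihedral reflection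
  subgroup contains a crown \<open>x \<rightarrow> a, b \<rightarrow> c, d \<rightarrow> y\<close> of strictly shorter edges. Conversely, whenever such
  edges exist, in whatever directions, with \<open>a \<noteq> b\<close> and \<open>c \<noteq> d\<close>, then \<open>x\<close> and \<open>y\<close> are adjacent. A special
  matching preserves the shorter edges by induction, hence it preserves the long one. A cover
  \<open>x \<lessdot> y\<close> is sent to a cover or to an edge of the matching, except when \<open>M x \<lessdot> x \<lessdot> y \<lessdot> M y\<close>; the
  special matching condition then forces \<open>[M x, M y]\<close> to be a crown of this kind.

  The facts about dihedral subgroups come from the root system of the geometric representation: if
  \<open>t u = t' u' \<noteq> 1\<close> for reflections, the roots of \<open>t, u\<close> and those of \<open>t', u'\<close> span the same plane, and the
  reflections with roots in a plane generate a dihedral group with two canonical generators.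
\<close>

text \<open>The bound 3 comes from parity: reflections have odd length, so an edge has length
  difference 1 or at least 3. The obstacle is that lengths are measured in all of \<open>G\<close>,
  while crowns live in cosets of dihedral subgroups whose generators need not lie in
  \<open>S\<close>. The pivotal statement is therefore \<open>plane_coset_levels\<close>: on such a
  coset the length in \<open>G\<close> grows strictly with the dihedral length. It rests on signs of
  roots: \<open>w\<close> becomes shorter when multiplied by \<open>t\<close> on the right exactly
  if \<open>w\<close> makes the positive root of \<open>t\<close> negative, and signs multiply under
  composition (\<open>inverts_mult\<close>). The presentation of \<open>G\<close> enters at two
  places only, the parity of the length and the well-definedness of the linear action. That covers
  have length difference 1 is not assumed; \<open>cover_iff\<close> reads it off from the crowns of
  long edges.\<close>

context group
begin

text \<open>The elements of the dihedral group generated by two involutions, indexed by \<open>\<int>\<close> so that right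
  multiplication by \<open>p\<close> or \<open>q\<close> moves the index by one: index \<open>k \<ge> 0\<close> is the alternating product
  \<open>p q p \<dots>\<close> with \<open>k\<close> factors, and index \<open>- k\<close> is \<open>q p q \<dots>\<close> with \<open>k\<close> factors.\<close>

definition dih_elt :: "'a \<Rightarrow> 'a \<Rightarrow> int \<Rightarrow> 'a" where
  "dih_elt p q k = (if even k then (p \<otimes> q) [^] (k div 2) else (p \<otimes> q) [^] (k div 2) \<otimes> p)"

context
  fixes p q assumes p: "p \<in> carrier G" "p \<otimes> p = \<one>" and q: "q \<in> carrier G" "q \<otimes> q = \<one>"
begin

lemma dih_elt_closed [simp]: "dih_elt p q k \<in> carrier G"
  using p q by (simp add: dih_elt_def)

lemma dih_elt_0 [simp]: "dih_elt p q 0 = \<one>"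
  by (simp add: dih_elt_def)

lemma dih_elt_1: "dih_elt p q 1 = p"
  using p by (simp add: dih_elt_def)

lemma invol_cancel: "x \<in> carrier G \<Longrightarrow> p \<otimes> (p \<otimes> x) = x" "x \<in> carrier G \<Longrightarrow> q \<otimes> (q \<otimes> x) = x"
  using p q by (simp_all flip: m_assoc)

lemma invol_inv: "inv p = p" "inv q = q"
  using p q by (auto intro: inv_equality)

text \<open>Conjugation by \<open>p\<close> inverts the rotation \<open>p \<otimes> q\<close>,
  because it turns it into \<open>q \<otimes> p\<close>; powers follow.\<close>

lemma rot_flip: "p \<otimes> (p \<otimes> q) [^] (j::int) = (p \<otimes> q) [^] (-j) \<otimes> p"
proof -
  have nat: "p \<otimes> (p \<otimes> q) [^] (n::nat) \<otimes> p = (q \<otimes> p) [^] n" for n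
  proof (induction n)
    case (Suc n)
    have "p \<otimes> (p \<otimes> q) [^] Suc n \<otimes> p = (p \<otimes> (p \<otimes> q) [^] n \<otimes> p) \<otimes> (q \<otimes> p)"
      using p q by (simp add: m_assoc invol_cancel)
    then show ?case using Suc by simp
  qed (use p in simp)
  have inv: "inv (p \<otimes> q) = q \<otimes> p"
    using p q by (simp add: inv_mult_group invol_inv)
  have inv': "inv (q \<otimes> p) = p \<otimes> q"
    using p q by (simp add: inv_mult_group invol_inv)
  have "p \<otimes> (p \<otimes> q) [^] j \<otimes> p = (p \<otimes> q) [^] (-j)"
  proof (cases "j \<ge> 0")
    case True
    then obtain n where n: "j = int n" using nonneg_int_cases by blast
    have "(p \<otimes> q) [^] (- j) = (q \<otimes> p) [^] n"
      using p q by (simp add: n int_pow_neg_int nat_pow_inv[symmetric] inv)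
    then show ?thesis using nat[of n] by (simp add: n int_pow_int)
  next
    case False
    then obtain n where n: "j = - int n" using nonpos_int_cases by (metis linorder_not_le less_imp_le)
    have "(p \<otimes> q) [^] j = (q \<otimes> p) [^] n"
      using p q by (simp add: n int_pow_neg_int nat_pow_inv[symmetric] inv)
    moreover have "p \<otimes> (q \<otimes> p) [^] n \<otimes> p = (p \<otimes> q) [^] n"
      using p q nat[of n] by (simp flip: nat[of n]) (simp add: m_assoc invol_cancel)
    ultimately show ?thesis by (simp add: n int_pow_int)
  qed
  then have "p \<otimes> (p \<otimes> q) [^] j \<otimes> p \<otimes> p = (p \<otimes> q) [^] (-j) \<otimes> p" by simp
  then show ?thesis using p q by (simp add: m_assoc)
qed

lemma rot_mult: "(p \<otimes> q) [^] (i::int) \<otimes> (p \<otimes> q) [^] (j::int) = (p \<otimes> q) [^] (i + j)"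
  using p q by (simp add: int_pow_mult)

lemma rot_mult': "x \<in> carrier G \<Longrightarrow>
    (p \<otimes> q) [^] (i::int) \<otimes> ((p \<otimes> q) [^] (j::int) \<otimes> x) = (p \<otimes> q) [^] (i + j) \<otimes> x"
  using p q by (simp flip: m_assoc rot_mult)

lemma rot_flip': "x \<in> carrier G \<Longrightarrow> p \<otimes> ((p \<otimes> q) [^] (j::int) \<otimes> x) = (p \<otimes> q) [^] (-j) \<otimes> (p \<otimes> x)"
  using p q rot_flip[of j] by (simp flip: m_assoc)

text \<open>Even indices are rotations and odd indices are reflections, so left multiplication acts
  on the index line by a translation here and by a point reflection in
  \<open>dih_elt_mult_odd\<close>. Later computations in dihedral groups reduce to these two
  rules.\<close>

lemma dih_elt_mult_even: "even i \<Longrightarrow> dih_elt p q i \<otimes> dih_elt p q j = dih_elt p q (i + j)"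
  using p q by (auto simp: dih_elt_def rot_mult rot_mult' elim!: evenE)

lemma dih_elt_mult_odd: "odd i \<Longrightarrow> dih_elt p q i \<otimes> dih_elt p q j = dih_elt p q (i - j)"
proof -
  have half: "(2 * b + 1 - 2 * a) div 2 = b - a" for a b :: int by presburger
  show "odd i \<Longrightarrow> dih_elt p q i \<otimes> dih_elt p q j = dih_elt p q (i - j)"
    using p q
    by (auto simp: dih_elt_def m_assoc rot_mult rot_mult' rot_flip rot_flip' invol_cancel elim!: evenE oddE)
      (simp_all add: half)
qed

lemma dih_elt_inv: "inv (dih_elt p q k) = dih_elt p q (if even k then - k else k)"
proof (rule inv_equality)
  show "dih_elt p q (if even k then - k else k) \<otimes> dih_elt p q k = \<one>"
    by (simp add: dih_elt_mult_even dih_elt_mult_odd)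
qed auto

lemma dih_elt_m1: "dih_elt p q (-1) = q"
proof -
  have "dih_elt p q 1 \<otimes> dih_elt p q 2 = dih_elt p q (-1)" by (simp add: dih_elt_mult_odd)
  then show ?thesis using p q by (simp add: dih_elt_def invol_cancel)
qed

lemma dih_elt_Suc: "dih_elt p q k \<otimes> (if even k then p else q) = dih_elt p q (k + 1)"
  using dih_elt_mult_even[of k 1] dih_elt_mult_odd[of k "-1"] by (auto simp: dih_elt_1 dih_elt_m1)

lemma dih_elt_pred: "dih_elt p q k \<otimes> (if even k then q else p) = dih_elt p q (k - 1)"
  using dih_elt_mult_even[of k "-1"] dih_elt_mult_odd[of k "1"] by (auto simp: dih_elt_1 dih_elt_m1)

lemma mult_dih_elt: "p \<otimes> dih_elt p q k = dih_elt p q (1 - k)" "q \<otimes> dih_elt p q k = dih_elt p q (-1 - k)"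
  using dih_elt_mult_odd[of 1 k] dih_elt_mult_odd[of "-1" k] by (auto simp: dih_elt_1 dih_elt_m1)

lemma dih_elt_period:
  assumes "(p \<otimes> q) [^] (m::nat) = \<one>" shows "dih_elt p q (k + 2 * int m) = dih_elt p q k"
proof -
  have "dih_elt p q (2 * int m) = \<one>" using assms by (simp add: dih_elt_def int_pow_int)
  then show ?thesis using dih_elt_mult_even[of "2 * int m" k] by (simp add: add.commute)
qed

end
end

text \<open>Two terms suffice: every linear argument takes place in a plane, and linearity of the
  action becomes a single equation.\<close>

definition lin_comb :: "real \<Rightarrow> ('i \<Rightarrow> real) \<Rightarrow> real \<Rightarrow> ('i \<Rightarrow> real) \<Rightarrow> 'i \<Rightarrow> real" where
  "lin_comb x f y g = (\<lambda>i. x * f i + y * g i)"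

text \<open>The form in which the presentation is used: a function of words that is unchanged by
  deleting a relator depends only on the product of the word.\<close>

lemma equivclp_invariant:
  assumes "equivclp r x y" and "\<And>a b. r a b \<Longrightarrow> f a = f b"
  shows "f x = f y"
  using assms(1) by (induction rule: equivclp_induct) (auto dest: assms(2))

section \<open>Words over the generators and their products\<close>

locale coxeter = group G for G :: "('a, 'b) monoid_scheme" (structure) +
  fixes S :: "'a set"
  assumes coxeter_system: "coxeter_system G S"
begin

abbreviation T :: "'a set" where "T \<equiv> reflections G S"
abbreviation len :: "'a \<Rightarrow> nat" where "len \<equiv> cox_length G S"
abbreviation wprod :: "'a list \<Rightarrow> 'a" where "wprod \<equiv> word_prod G"

lemma S_carrier: "s \<in> S \<Longrightarrow> s \<in> carrier G"
  using coxeter_system by (auto simp: coxeter_system_def)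

lemma lists_S_carrier: "ws \<in> lists S \<Longrightarrow> ws \<in> lists (carrier G)"
  using S_carrier by auto

lemma S_square: "s \<in> S \<Longrightarrow> s \<otimes> s = \<one>"
  using coxeter_system by (auto simp: coxeter_system_def)

lemma one_notin_S: "\<one> \<notin> S"
  using coxeter_system by (auto simp: coxeter_system_def)

lemma S_inv: "s \<in> S \<Longrightarrow> inv s = s"
  using S_square S_carrier inv_equality by blast

lemma word_exists: "w \<in> carrier G \<Longrightarrow> \<exists>ws\<in>lists S. wprod ws = w"
  using coxeter_system by (auto simp: coxeter_system_def)

lemma words_equiv:
  "\<lbrakk>ws \<in> lists S; ws' \<in> lists S; wprod ws = wprod ws'\<rbrakk> \<Longrightarrow> equivclp (coxeter_step G S) ws ws'"
  using coxeter_system unfolding coxeter_system_def by blast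

lemma wprod_Nil [simp]: "wprod [] = \<one>" and wprod_Cons [simp]: "wprod (s # ws) = s \<otimes> wprod ws"
  by (simp_all add: word_prod_def)

lemma wprod_closed [simp]: "ws \<in> lists (carrier G) \<Longrightarrow> wprod ws \<in> carrier G"
  by (induction ws) auto

lemma wprod_closed_S [simp]: "ws \<in> lists S \<Longrightarrow> wprod ws \<in> carrier G"
  using lists_S_carrier by simp

lemma wprod_append:
  "\<lbrakk>xs \<in> lists (carrier G); ys \<in> lists (carrier G)\<rbrakk> \<Longrightarrow> wprod (xs @ ys) = wprod xs \<otimes> wprod ys"
  by (induction xs) (auto simp: m_assoc)

lemma wprod_rev: "ws \<in> lists S \<Longrightarrow> wprod (rev ws) = inv (wprod ws)"
proof (induction ws)
  case (Cons s ws)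
  then have "s \<in> S" "ws \<in> lists S" by auto
  then show ?case
    using Cons.IH wprod_append[of "rev ws" "[s]"] lists_S_carrier[of "rev ws"]
    by (simp add: in_lists_conv_set S_carrier inv_mult_group S_inv)
qed simp

lemma mult_inv_cancel [simp]:
  "\<lbrakk>x \<in> carrier G; y \<in> carrier G\<rbrakk> \<Longrightarrow> x \<otimes> (inv x \<otimes> y) = y"
  "\<lbrakk>x \<in> carrier G; y \<in> carrier G\<rbrakk> \<Longrightarrow> inv x \<otimes> (x \<otimes> y) = y"
  by (simp_all flip: m_assoc)

subsection \<open>Length\<close>

lemma reduced_word: "w \<in> carrier G \<Longrightarrow> \<exists>ws\<in>lists S. length ws = len w \<and> wprod ws = w"
  unfolding cox_length_def
  by (rule LeastI_ex) (use word_exists in blast)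

lemma len_wprod_le: "ws \<in> lists S \<Longrightarrow> len (wprod ws) \<le> length ws"
  unfolding cox_length_def by (rule Least_le) blast

lemma len_one [simp]: "len \<one> = 0"
  using len_wprod_le[of "[]"] by simp

lemma len_eq_0: "w \<in> carrier G \<Longrightarrow> len w = 0 \<longleftrightarrow> w = \<one>"
  using reduced_word[of w] by auto

text \<open>Every relator \<open>(s t)^n\<close> is a word of even length \<open>2 n\<close>, so
  deleting it keeps the parity.\<close>

lemma even_len_wprod:
  assumes "ws \<in> lists S" shows "even (len (wprod ws)) \<longleftrightarrow> even (length ws)"
proof -
  obtain vs where vs: "vs \<in> lists S" "length vs = len (wprod ws)" "wprod vs = wprod ws"
    using reduced_word assms by (metis wprod_closed_S)
  have "even (length vs) = even (length ws)"
  proof (rule equivclp_invariant[OF words_equiv[OF vs(1) assms vs(3)]])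
    fix a b assume "coxeter_step G S a b"
    then show "even (length a) = even (length b)"
      by cases (simp add: length_concat sum_list_replicate)
  qed
  then show ?thesis using vs by simp
qed

lemma even_len_mult:
  assumes "x \<in> carrier G" "y \<in> carrier G"
  shows "even (len (x \<otimes> y)) \<longleftrightarrow> (even (len x) \<longleftrightarrow> even (len y))"
proof -
  obtain xs ys where "xs \<in> lists S" "wprod xs = x" "ys \<in> lists S" "wprod ys = y"
    using assms word_exists by meson
  then show ?thesis
    using even_len_wprod[of xs] even_len_wprod[of ys] even_len_wprod[of "xs @ ys"]
    by (simp add: wprod_append lists_S_carrier)
qed

lemma len_mult_le:
  assumes "x \<in> carrier G" "y \<in> carrier G"
  shows "len (x \<otimes> y) \<le> len x + len y"
proof -
  obtain xs ys where "xs \<in> lists S" "wprod xs = x" "length xs = len x"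
    "ys \<in> lists S" "wprod ys = y" "length ys = len y"
    using assms reduced_word by meson
  then show ?thesis
    using len_wprod_le[of "xs @ ys"] by (simp add: wprod_append lists_S_carrier)
qed

lemma len_S: "s \<in> S \<Longrightarrow> len s = 1"
  using len_wprod_le[of "[s]"] len_eq_0[of s] one_notin_S S_carrier[of s]
  by (cases "s = \<one>") (auto simp: le_Suc_eq)

lemma len_inv:
  assumes "w \<in> carrier G" shows "len (inv w) = len w"
proof -
  have le: "len (inv w) \<le> len w" if "w \<in> carrier G" for w
  proof -
    obtain ws where "ws \<in> lists S" "length ws = len w" "wprod ws = w"
      using reduced_word \<open>w \<in> carrier G\<close> by blast
    then show ?thesis using len_wprod_le[of "rev ws"] wprod_rev[of ws] by (auto simp: in_lists_conv_set)
  qed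
  from le[of w] le[of "inv w"] assms show ?thesis by (metis inv_closed inv_inv le_antisym)
qed

lemma T_carrier: "t \<in> T \<Longrightarrow> t \<in> carrier G"
  unfolding reflections_def using S_carrier by auto

lemma S_T: "s \<in> S \<Longrightarrow> s \<in> T"
  unfolding reflections_def using S_carrier
  by (intro CollectI exI[of _ \<one>] exI[of _ s]) simp

lemma T_square:
  assumes "t \<in> T" shows "t \<otimes> t = \<one>"
proof -
  obtain v s where v: "t = v \<otimes> s \<otimes> inv v" "v \<in> carrier G" "s \<in> S"
    using assms by (auto simp: reflections_def)
  then have "t \<otimes> t = v \<otimes> (s \<otimes> s) \<otimes> inv v"
    using S_carrier by (simp add: m_assoc)
  then show ?thesis using v S_square by simp
qed

lemma T_inv: "t \<in> T \<Longrightarrow> inv t = t"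
  using T_square T_carrier inv_equality by blast

lemma T_cancel: "\<lbrakk>t \<in> T; x \<in> carrier G\<rbrakk> \<Longrightarrow> t \<otimes> (t \<otimes> x) = x"
  using T_square T_carrier by (simp flip: m_assoc)

lemma T_conj: "\<lbrakk>t \<in> T; w \<in> carrier G\<rbrakk> \<Longrightarrow> w \<otimes> t \<otimes> inv w \<in> T"
proof -
  assume "t \<in> T" "w \<in> carrier G"
  then obtain v s where v: "t = v \<otimes> s \<otimes> inv v" "v \<in> carrier G" "s \<in> S"
    by (auto simp: reflections_def)
  then have "w \<otimes> t \<otimes> inv w = (w \<otimes> v) \<otimes> s \<otimes> inv (w \<otimes> v)"
    using \<open>w \<in> carrier G\<close> S_carrier by (simp add: inv_mult_group m_assoc)
  then show ?thesis unfolding reflections_def using v \<open>w \<in> carrier G\<close> by blast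
qed

lemma odd_len_T: "t \<in> T \<Longrightarrow> odd (len t)"
  unfolding reflections_def using S_carrier
  by (auto simp: even_len_mult len_inv len_S)

lemma len_mult_T_neq: "\<lbrakk>w \<in> carrier G; t \<in> T\<rbrakk> \<Longrightarrow> len (w \<otimes> t) \<noteq> len w"
  using even_len_mult[of w t] odd_len_T T_carrier by metis

lemma len_mult_S:
  assumes "w \<in> carrier G" "s \<in> S"
  shows "len (w \<otimes> s) = Suc (len w) \<or> len w = Suc (len (w \<otimes> s))"
  using len_mult_le[of w s] len_mult_le[of "w \<otimes> s" s] len_mult_T_neq[of w s]
    assms S_T[of s] S_carrier[of s] len_S[of s] by (auto simp: m_assoc S_square)

lemma S_len_mult:
  assumes "w \<in> carrier G" "s \<in> S"
  shows "len (s \<otimes> w) = Suc (len w) \<or> len w = Suc (len (s \<otimes> w))"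
  using len_mult_S[of "inv w" s] assms len_inv[of "s \<otimes> w"] len_inv[of w]
  by (simp add: inv_mult_group S_inv S_carrier)

lemma left_descent:
  assumes "w \<in> carrier G" "w \<noteq> \<one>"
  shows "\<exists>s\<in>S. len w = Suc (len (s \<otimes> w))"
proof -
  obtain ws where ws: "ws \<in> lists S" "length ws = len w" "wprod ws = w"
    using reduced_word assms by blast
  moreover have "ws \<noteq> []" using ws assms by auto
  ultimately obtain s vs where "ws = s # vs" "s \<in> S" "vs \<in> lists S"
    by (cases ws) auto
  then have "s \<otimes> w = wprod vs" "len (wprod vs) < len w"
    using ws len_wprod_le[of vs] by (auto simp: T_cancel S_T simp flip: ws(3))
  then show ?thesis using S_len_mult[of w s] assms \<open>s \<in> S\<close> by force
qed

lemma right_descent: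
  assumes "w \<in> carrier G" "w \<noteq> \<one>"
  shows "\<exists>s\<in>S. len w = Suc (len (w \<otimes> s))"
proof -
  obtain s where "s \<in> S" "len (inv w) = Suc (len (s \<otimes> inv w))"
    using left_descent[of "inv w"] assms inv_eq_1_iff by auto
  then show ?thesis using assms len_inv[of "w \<otimes> s"] len_inv[of w]
    by (auto simp: inv_mult_group S_inv S_carrier)
qed

subsection \<open>The geometric representation\<close>

text \<open>The Tits form on simple roots. \<open>ord\<close> is 0 for elements of infinite order;
  the value -1 is then the limit of \<open>- cos (pi / m)\<close>.\<close>

definition bilin :: "'a \<Rightarrow> 'a \<Rightarrow> real" where
  "bilin s r = (if s = r then 1 else if ord (s \<otimes> r) = 0 then -1 else - cos (pi / ord (s \<otimes> r)))"

text \<open>A vector \<open>f\<close> records its coefficients \<open>f (Inr r)\<close> and, independently, its pairings \<open>f (Inl r)\<close>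
  with the simple coroots. Keeping the two apart makes the pairing nondegenerate even when the
  Tits form is degenerate, which is what the argument about products of two reflections needs,
  and avoids sums over a possibly infinite \<open>S\<close>.\<close>

definition alpha :: "'a \<Rightarrow> 'a + 'a \<Rightarrow> real" where
  "alpha s = case_sum (\<lambda>r. 2 * bilin s r) (\<lambda>r. if r = s then 1 else 0)"

definition simple_refl :: "'a \<Rightarrow> ('a + 'a \<Rightarrow> real) \<Rightarrow> 'a + 'a \<Rightarrow> real" where
  "simple_refl s f = (\<lambda>i. f i - f (Inl s) * alpha s i)"

definition act_word :: "'a list \<Rightarrow> ('a + 'a \<Rightarrow> real) \<Rightarrow> 'a + 'a \<Rightarrow> real" where
  "act_word ws f = foldr simple_refl ws f"

lemma act_word_simps [simp]: "act_word [] f = f" "act_word (s # ws) f = simple_refl s (act_word ws f)"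
  "act_word (xs @ ys) f = act_word xs (act_word ys f)"
  by (simp_all add: act_word_def)

lemma alpha_simps [simp]: "alpha s (Inl r) = 2 * bilin s r" "alpha s (Inr r) = (if r = s then 1 else 0)"
  by (simp_all add: alpha_def)

lemma bilin_self [simp]: "bilin s s = 1" by (simp add: bilin_def)

lemma bilin_sym: "\<lbrakk>s \<in> S; r \<in> S\<rbrakk> \<Longrightarrow> bilin s r = bilin r s"
proof -
  assume "s \<in> S" "r \<in> S"
  then have "inv (s \<otimes> r) = r \<otimes> s" by (simp add: inv_mult_group S_carrier S_inv)
  then have "ord (r \<otimes> s) = ord (s \<otimes> r)"
    using ord_inv[of "s \<otimes> r"] \<open>s \<in> S\<close> \<open>r \<in> S\<close> by (simp add: S_carrier)
  then show ?thesis by (auto simp: bilin_def)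
qed

lemma simple_refl_lin_comb: "simple_refl s (lin_comb x f y g) = lin_comb x (simple_refl s f) y (simple_refl s g)"
  by (auto simp: simple_refl_def lin_comb_def algebra_simps)

lemma act_word_lin_comb: "act_word ws (lin_comb x f y g) = lin_comb x (act_word ws f) y (act_word ws g)"
  by (induction ws) (simp_all add: simple_refl_lin_comb)

lemma simple_refl_simple_refl [simp]: "simple_refl s (simple_refl s f) = f"
  by (auto simp: simple_refl_def algebra_simps)

lemma simple_refl_alpha_comb1: "simple_refl s (lin_comb x (alpha s) y (alpha t)) = lin_comb (- 2 * bilin t s * y - x) (alpha s) y (alpha t)"
  by (auto simp: simple_refl_def lin_comb_def algebra_simps)

lemma simple_refl_alpha_comb2: "simple_refl t (lin_comb x (alpha s) y (alpha t)) = lin_comb x (alpha s) (- 2 * bilin s t * x - y) (alpha t)"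
  by (auto simp: simple_refl_def lin_comb_def algebra_simps)

lemma ord_neq_1: "\<lbrakk>s \<in> S; t \<in> S; s \<noteq> t\<rbrakk> \<Longrightarrow> ord (s \<otimes> t) \<noteq> 1"
  using S_inv[of t] S_carrier inv_equality[of s t] ord_eq_1[of "s \<otimes> t"] by auto

lemma sin_step: "2 * cos \<theta> * sin (\<psi> + \<theta>) - sin \<psi> = sin (\<psi> + 2 * (\<theta>::real))"
proof -
  have "sin (\<psi> + 2 * \<theta>) + sin \<psi> = sin ((\<psi> + \<theta>) + \<theta>) + sin ((\<psi> + \<theta>) - \<theta>)"
    by (simp add: algebra_simps)
  also have "\<dots> = 2 * cos \<theta> * sin (\<psi> + \<theta>)"
    unfolding sin_add[of "\<psi> + \<theta>"] sin_diff[of "\<psi> + \<theta>"] by simp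
  finally show ?thesis by simp
qed

text \<open>If \<open>s \<otimes> t\<close> has infinite order, then \<open>n = 0\<close>. Otherwise
  \<open>s t\<close> rotates the plane of \<open>alpha s\<close> and \<open>alpha t\<close> by twice
  \<open>pi / m\<close>, so its power is the identity there. An arbitrary \<open>f\<close> splits
  into a vector \<open>w\<close> of this plane and a vector \<open>g\<close> with both pairings
  zero, which \<open>s\<close> and \<open>t\<close> fix.\<close>

lemma relation_fixes:
  assumes st: "s \<in> S" "t \<in> S" and n: "(s \<otimes> t) [^] (n::nat) = \<one>"
  shows "act_word (concat (replicate n [s, t])) f = f"
proof (cases "s = t")
  case True
  then show ?thesis by (induction n) simp_all
next
  case False
  define m where "m = ord (s \<otimes> t)"
  have dvd: "m dvd n" using n pow_eq_id st S_carrier by (auto simp: m_def)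
  show ?thesis
  proof (cases "m = 0")
    case True
    then show ?thesis using dvd by simp
  next
    case m0: False
    have "m \<ge> 2" using m0 ord_neq_1[OF st False] by (simp add: m_def)
    define \<theta> where "\<theta> = pi / m"
    have th: "0 < \<theta>" "\<theta> < pi" using \<open>m \<ge> 2\<close> by (auto simp: \<theta>_def field_simps)
    then have sin: "sin \<theta> > 0" by (rule sin_gt_zero)
    have bilin: "bilin s t = - cos \<theta>" "bilin t s = - cos \<theta>"
      using False m0 bilin_sym[OF st] by (auto simp: bilin_def m_def \<theta>_def)
    \<comment> \<open>Parametrises the orbits of the rotation: \<open>s t\<close> shifts the angle
      by \<open>2 * \<theta>\<close>, which \<open>sin_step\<close> verifies on the
      coefficients.\<close>
    define v where "v = (\<lambda>\<psi>. lin_comb (sin (\<psi> + \<theta>)) (alpha s) (sin \<psi>) (alpha t))"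
    have step: "simple_refl s (simple_refl t (v \<psi>)) = v (\<psi> + 2 * \<theta>)" for \<psi>
      using sin_step[of \<theta> \<psi>] sin_step[of \<theta> "\<psi> + \<theta>"]
      by (simp add: v_def simple_refl_alpha_comb1 simple_refl_alpha_comb2 bilin algebra_simps)
    have iter: "act_word (concat (replicate k [s, t])) (v \<psi>) = v (\<psi> + 2 * real k * \<theta>)" for k \<psi>
      by (induction k) (simp_all add: step algebra_simps)
    obtain k where k: "n = m * k" using dvd by blast
    have "2 * real n * \<theta> = 2 * real k * pi" using m0 by (simp add: k \<theta>_def)
    then have "sin (2 * real n * \<theta>) = 0" "cos (2 * real n * \<theta>) = 1"
      by (simp_all only: sin_2npi cos_2npi)
    then have fix_v: "act_word (concat (replicate n [s, t])) (v \<psi>) = v \<psi>" for \<psi>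
      unfolding iter by (simp add: v_def sin_add cos_add)
    \<comment> \<open>Cramer's rule for the vector of the plane with the same two pairings as
      \<open>f\<close>; the determinant \<open>4 - 4 cos^2\<close> equals \<open>4 sin^2\<close>,
      which is nonzero.\<close>
    define a b where "a = (2 * f (Inl s) + 2 * cos \<theta> * f (Inl t)) / (4 * (sin \<theta>)\<^sup>2)"
      and "b = (2 * f (Inl t) + 2 * cos \<theta> * f (Inl s)) / (4 * (sin \<theta>)\<^sup>2)"
    \<comment> \<open>\<open>v 0\<close> is \<open>sin \<theta>\<close> times \<open>alpha s\<close>
      and \<open>v (-\<theta>)\<close> is \<open>- sin \<theta>\<close> times
      \<open>alpha t\<close>.\<close>
    define w where "w = lin_comb (a / sin \<theta>) (v 0) (- b / sin \<theta>) (v (-\<theta>))"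
    have w: "w i = a * alpha s i + b * alpha t i" for i
      using sin by (simp add: w_def lin_comb_def v_def)
    have ws: "w (Inl s) = f (Inl s)" "w (Inl t) = f (Inl t)"
    proof -
      define D where "D = 4 * (sin \<theta>)\<^sup>2"
      have D: "D \<noteq> 0" "D = 4 - 4 * (cos \<theta>)\<^sup>2"
        using sin by (simp_all add: D_def) (simp add: sin_squared_eq)
      have ab: "a * D = 2 * f (Inl s) + 2 * cos \<theta> * f (Inl t)" "b * D = 2 * f (Inl t) + 2 * cos \<theta> * f (Inl s)"
        using D(1) by (simp_all add: a_def b_def flip: D_def)
      have "(2 * a - 2 * cos \<theta> * b) * D = 2 * (a * D) - 2 * cos \<theta> * (b * D)"
        "(2 * b - 2 * cos \<theta> * a) * D = 2 * (b * D) - 2 * cos \<theta> * (a * D)" by (simp_all add: algebra_simps)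
      moreover have "2 * (a * D) - 2 * cos \<theta> * (b * D) = f (Inl s) * (4 - 4 * (cos \<theta>)\<^sup>2)"
        "2 * (b * D) - 2 * cos \<theta> * (a * D) = f (Inl t) * (4 - 4 * (cos \<theta>)\<^sup>2)"
        unfolding ab by (simp_all add: algebra_simps power2_eq_square)
      ultimately have "(2 * a - 2 * cos \<theta> * b) * D = f (Inl s) * D" "(2 * b - 2 * cos \<theta> * a) * D = f (Inl t) * D"
        by (simp_all only: D(2)[symmetric])
      then have "2 * a - 2 * cos \<theta> * b = f (Inl s)" "2 * b - 2 * cos \<theta> * a = f (Inl t)"
        using D(1) by simp_all
      then show "w (Inl s) = f (Inl s)" "w (Inl t) = f (Inl t)"
        unfolding w by (simp_all add: bilin algebra_simps)
    qed
    define g where "g = lin_comb 1 f (-1) w"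
    have fix_w: "act_word (concat (replicate n [s, t])) w = w"
      unfolding w_def by (simp only: act_word_lin_comb fix_v)
    have "g (Inl s) = 0" "g (Inl t) = 0" by (simp_all add: g_def lin_comb_def ws)
    then have "simple_refl s g = g" "simple_refl t g = g" by (simp_all add: simple_refl_def)
    then have fix_g: "act_word (concat (replicate n [s, t])) g = g" by (induction n) simp_all
    have "f = lin_comb 1 g 1 w" by (auto simp: g_def lin_comb_def)
    then show ?thesis by (metis act_word_lin_comb fix_g fix_w)
  qed
qed

definition act :: "'a \<Rightarrow> ('a + 'a \<Rightarrow> real) \<Rightarrow> 'a + 'a \<Rightarrow> real" where
  "act w = act_word (SOME ws. ws \<in> lists S \<and> wprod ws = w)"

text \<open>Two words for the same element are linked by relator deletions, which act trivially, so
  the choice in \<open>act\<close> is immaterial.\<close>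

lemma act_wprod:
  assumes "ws \<in> lists S" shows "act (wprod ws) = act_word ws"
proof -
  define vs where "vs = (SOME vs. vs \<in> lists S \<and> wprod vs = wprod ws)"
  have vs: "vs \<in> lists S \<and> wprod vs = wprod ws"
    unfolding vs_def by (rule someI[of _ ws]) (use assms in simp)
  have "equivclp (coxeter_step G S) vs ws" using vs assms words_equiv by blast
  then have "act_word vs = act_word ws"
  proof (rule equivclp_invariant)
    fix a b assume "coxeter_step G S a b"
    then show "act_word a = act_word b"
      by cases (auto simp: relation_fixes)
  qed
  then show ?thesis by (simp add: act_def vs_def)
qed

lemma act_mult:
  assumes "x \<in> carrier G" "y \<in> carrier G" shows "act (x \<otimes> y) f = act x (act y f)"
proof -
  obtain xs ys where "xs \<in> lists S" "wprod xs = x" "ys \<in> lists S" "wprod ys = y"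
    using assms word_exists by meson
  then show ?thesis
    using act_wprod[of xs] act_wprod[of ys] act_wprod[of "xs @ ys"]
    by (simp add: wprod_append lists_S_carrier)
qed

lemma act_one [simp]: "act \<one> f = f"
  using act_wprod[of "[]"] by simp

lemma act_S: "s \<in> S \<Longrightarrow> act s = simple_refl s"
  using act_wprod[of "[s]"] S_carrier by (auto simp: fun_eq_iff)

lemma act_lin_comb: "w \<in> carrier G \<Longrightarrow> act w (lin_comb x f y g) = lin_comb x (act w f) y (act w g)"
  using word_exists[of w] act_wprod act_word_lin_comb by metis

lemma act_inv [simp]: "w \<in> carrier G \<Longrightarrow> act (inv w) (act w f) = f"
  "w \<in> carrier G \<Longrightarrow> act w (act (inv w) f) = f"
  by (simp_all flip: act_mult)

subsection \<open>Roots\<close>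

text \<open>The value on \<open>f\<close> of the coroot of \<open>b\<close>, obtained by expanding
  \<open>b\<close> in simple roots and replacing each by its simple coroot. It is meaningful for
  vectors of finite support, such as roots.\<close>

definition pairing :: "('a + 'a \<Rightarrow> real) \<Rightarrow> ('a + 'a \<Rightarrow> real) \<Rightarrow> real" where
  "pairing b f = (\<Sum>x | b (Inr x) \<noteq> 0. b (Inr x) * f (Inl x))"

definition roots :: "('a + 'a \<Rightarrow> real) set" where
  "roots = {act w (alpha s) | w s. w \<in> carrier G \<and> s \<in> S}"

text \<open>One induction on a word for \<open>w\<close> gives all three claims with a common finite
  support. The second says that on roots the \<open>Inl\<close> coordinates are those dictated by
  the Tits form; the third is the invariance of the pairing.\<close>

lemma root_expansion:
  assumes "w \<in> carrier G" "s \<in> S"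
  defines "b \<equiv> act w (alpha s)"
  shows "finite {x. b (Inr x) \<noteq> 0}"
    and "b i = (\<Sum>x | b (Inr x) \<noteq> 0. b (Inr x) * alpha x i)"
    and "act (inv w) f (Inl s) = pairing b f"
proof -
  have *: "\<exists>X. finite X \<and> X \<subseteq> S \<and> (\<forall>y. y \<notin> X \<longrightarrow> act_word ws (alpha s) (Inr y) = 0) \<and>
      (\<forall>i. act_word ws (alpha s) i = (\<Sum>x\<in>X. act_word ws (alpha s) (Inr x) * alpha x i)) \<and>
      (\<forall>f. act_word (rev ws) f (Inl s) = (\<Sum>x\<in>X. act_word ws (alpha s) (Inr x) * f (Inl x)))"
    if "ws \<in> lists S" for ws
    using that
  proof (induction ws)
    case Nil
    then show ?case using \<open>s \<in> S\<close> by (intro exI[of _ "{s}"]) auto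
  next
    case (Cons u ws)
    define c where "c = act_word ws (alpha s)"
    from Cons obtain X where X: "finite X" "X \<subseteq> S" and
        zero: "\<And>y. y \<notin> X \<Longrightarrow> c (Inr y) = 0" and
        expand: "\<And>i. c i = (\<Sum>x\<in>X. c (Inr x) * alpha x i)" and
        pair: "\<And>f. act_word (rev ws) f (Inl s) = (\<Sum>x\<in>X. c (Inr x) * f (Inl x))"
      unfolding c_def by blast
    have "u \<in> S" using Cons by auto
    \<comment> \<open>A simple reflection changes only the coefficient at \<open>u\<close>.\<close>
    have sum: "(\<Sum>x\<in>insert u X. simple_refl u c (Inr x) * g x) = (\<Sum>x\<in>X. c (Inr x) * g x) - c (Inl u) * g u" for g
    proof -
      have "(\<Sum>x\<in>insert u X. simple_refl u c (Inr x) * g x) =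
          (\<Sum>x\<in>insert u X. c (Inr x) * g x) - (\<Sum>x\<in>insert u X. if x = u then c (Inl u) * g u else 0)"
        unfolding sum_subtractf[symmetric] by (rule sum.cong) (auto simp: simple_refl_def algebra_simps)
      also have "(\<Sum>x\<in>insert u X. c (Inr x) * g x) = (\<Sum>x\<in>X. c (Inr x) * g x)"
        using X zero by (intro sum.mono_neutral_right) auto
      finally show ?thesis using X by simp
    qed
    \<comment> \<open>Symmetry of \<open>bilin\<close> moves the reflection from \<open>f\<close> to
      \<open>c\<close>; the remaining sum is the expansion of \<open>c (Inl u)\<close>.\<close>
    have "(\<Sum>x\<in>X. c (Inr x) * simple_refl u f (Inl x)) = (\<Sum>x\<in>X. c (Inr x) * f (Inl x)) - c (Inl u) * f (Inl u)" for f
    proof -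
      have "(\<Sum>x\<in>X. c (Inr x) * simple_refl u f (Inl x)) =
         (\<Sum>x\<in>X. c (Inr x) * f (Inl x)) - (\<Sum>x\<in>X. c (Inr x) * alpha x (Inl u)) * f (Inl u)"
        unfolding sum_subtractf[symmetric] sum_distrib_right
        using X \<open>u \<in> S\<close> by (intro sum.cong) (auto simp: simple_refl_def algebra_simps bilin_sym)
      then show ?thesis by (simp only: expand[of "Inl u", symmetric])
    qed
    then show ?case using X \<open>u \<in> S\<close> zero
      by (intro exI[of _ "insert u X"])
        (auto simp: sum pair simp flip: c_def expand, auto simp: simple_refl_def)
  qed
  obtain ws where ws: "ws \<in> lists S" "wprod ws = w" using assms word_exists by blast
  have b: "b = act_word ws (alpha s)" using act_wprod[OF ws(1)] ws(2) by (simp add: b_def)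
  have inv: "act (inv w) = act_word (rev ws)"
    using act_wprod[of "rev ws"] wprod_rev[of ws] ws by (simp add: in_lists_conv_set)
  obtain X where X: "finite X" "X \<subseteq> S" and
    zero: "\<And>y. y \<notin> X \<Longrightarrow> b (Inr y) = 0" and
    expand: "\<And>i. b i = (\<Sum>x\<in>X. b (Inr x) * alpha x i)" and
    pair: "\<And>f. act (inv w) f (Inl s) = (\<Sum>x\<in>X. b (Inr x) * f (Inl x))"
    using *[OF ws(1)] unfolding b inv by blast
  have sub: "{x. b (Inr x) \<noteq> 0} \<subseteq> X" using zero by blast
  show "finite {x. b (Inr x) \<noteq> 0}" using finite_subset[OF sub X(1)] .
  have sum: "(\<Sum>x | b (Inr x) \<noteq> 0. b (Inr x) * g x) = (\<Sum>x\<in>X. b (Inr x) * g x)" for g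
    using X sub by (intro sum.mono_neutral_left) auto
  show "b i = (\<Sum>x | b (Inr x) \<noteq> 0. b (Inr x) * alpha x i)"
    using expand sum by metis
  show "act (inv w) f (Inl s) = pairing b f" unfolding pairing_def pair sum ..
qed

lemma roots_act: "\<lbrakk>b \<in> roots; w \<in> carrier G\<rbrakk> \<Longrightarrow> act w b \<in> roots"
  unfolding roots_def using act_mult[of w] by (auto simp flip: act_mult) blast

lemma alpha_roots: "s \<in> S \<Longrightarrow> alpha s \<in> roots"
  unfolding roots_def by (intro CollectI exI[of _ \<one>] exI[of _ s]) (auto simp: fun_eq_iff)

lemma pairing_lin_comb: "pairing b (lin_comb x f y g) = x * pairing b f + y * pairing b g"
  by (simp add: pairing_def lin_comb_def sum_distrib_left sum.distrib algebra_simps)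

lemma pairing_self: "b \<in> roots \<Longrightarrow> pairing b b = 2"
proof -
  assume "b \<in> roots"
  then obtain w s where w: "b = act w (alpha s)" "w \<in> carrier G" "s \<in> S" by (auto simp: roots_def)
  then show ?thesis using root_expansion(3)[of w s b] by simp
qed

lemma root_nonzero:
  assumes "b \<in> roots" obtains y where "b (Inr y) \<noteq> 0"
proof -
  have "\<not> (\<forall>y. b (Inr y) = 0)"
  proof
    assume "\<forall>y. b (Inr y) = 0"
    then have "pairing b b = 0" by (simp add: pairing_def)
    then show False using pairing_self assms by simp
  qed
  then show ?thesis using that by blast
qed

text \<open>The simple coefficients determine the whole root by \<open>root_expansion\<close>, and
  \<open>pairing b b = 2\<close> forces the factor to square to 1.\<close>

lemma roots_proportional:
  assumes "b \<in> roots" "c \<in> roots" and proportional: "\<And>y. b (Inr y) = x * c (Inr y)"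
  shows "b i = x * c i" and "pairing b f = x * pairing c f" and "x = 1 \<or> x = -1"
proof -
  have "x \<noteq> 0" using root_nonzero[OF assms(1)] proportional by (metis mult_zero_left)
  then have supp: "{y. b (Inr y) \<noteq> 0} = {y. c (Inr y) \<noteq> 0}" by (auto simp: proportional)
  show scale: "b i = x * c i" for i
  proof -
    have c_eq: "c i = (\<Sum>y | c (Inr y) \<noteq> 0. c (Inr y) * alpha y i)"
      using assms(2) root_expansion(2) unfolding roots_def by blast
    have "b i = (\<Sum>y | b (Inr y) \<noteq> 0. b (Inr y) * alpha y i)"
      using assms(1) root_expansion(2) unfolding roots_def by blast
    also have "\<dots> = x * (\<Sum>y | c (Inr y) \<noteq> 0. c (Inr y) * alpha y i)"
      unfolding supp unfolding sum_distrib_left proportional mult.assoc ..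
    finally show ?thesis by (simp only: c_eq[symmetric])
  qed
  show pair: "pairing b f = x * pairing c f" for f
    unfolding pairing_def supp unfolding proportional sum_distrib_left mult.assoc ..
  have "pairing b b = x * pairing c (lin_comb x c 0 c)"
  proof -
    have "b = lin_comb x c 0 c" by (auto simp: lin_comb_def scale)
    then show ?thesis by (metis pair)
  qed
  then have "x * x = 1" using pairing_self assms by (simp add: pairing_lin_comb)
  then show "x = 1 \<or> x = -1" using square_eq_1_iff by blast
qed

lemma act_reflection:
  assumes "w \<in> carrier G" "s \<in> S"
  defines "b \<equiv> act w (alpha s)"
  shows "act (w \<otimes> s \<otimes> inv w) f = lin_comb 1 f (- pairing b f) b"
proof -
  have "act (w \<otimes> s \<otimes> inv w) f = act w (simple_refl s (act (inv w) f))"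
    using assms S_carrier by (simp add: act_mult act_S)
  also have "simple_refl s (act (inv w) f) = lin_comb 1 (act (inv w) f) (- pairing b f) (alpha s)"
    using root_expansion(3)[OF assms(1,2), of f] by (auto simp: b_def simple_refl_def lin_comb_def)
  also have "act w \<dots> = lin_comb 1 f (- pairing b f) b"
    using assms by (simp add: act_lin_comb b_def)
  finally show ?thesis .
qed

definition nonneg :: "('a + 'a \<Rightarrow> real) \<Rightarrow> bool" where
  "nonneg b \<longleftrightarrow> (\<forall>y. b (Inr y) \<ge> 0)"

lemma nonneg_lin_comb: "\<lbrakk>nonneg b; nonneg c; x \<ge> 0; y \<ge> 0\<rbrakk> \<Longrightarrow> nonneg (lin_comb x b y c)"
  by (simp add: nonneg_def lin_comb_def)

lemma nonneg_alpha: "nonneg (alpha s)" by (simp add: nonneg_def)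

text \<open>The sequence is \<open>sin (k \<theta>) / sin \<theta>\<close> with
  \<open>\<theta> = pi / m\<close>, nonnegative as long as \<open>k \<theta>\<close> is at most
  \<open>pi\<close>, and \<open>k\<close> itself if the order is infinite. It gives the coefficients
  of the roots of a rank two subsystem.\<close>

lemma sin_ratio_sequence:
  assumes "s \<in> S" "r \<in> S" "s \<noteq> r"
  obtains c :: "nat \<Rightarrow> real" where "c 0 = 0" "c 1 = 1"
    "\<And>k. c (k + 2) = - 2 * bilin s r * c (k + 1) - c k"
    "\<And>k. ord (r \<otimes> s) = 0 \<or> k \<le> ord (r \<otimes> s) \<Longrightarrow> c k \<ge> 0"
proof (cases "ord (r \<otimes> s) = 0")
  case True
  then have "bilin s r = -1" using bilin_sym assms by (simp add: bilin_def[of r s])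
  then show ?thesis by (intro that[of real]) auto
next
  case False
  define m where "m = ord (r \<otimes> s)"
  define \<theta> where "\<theta> = pi / m"
  have m: "m \<ge> 2" using ord_neq_1[of r s] assms False by (simp add: m_def)
  have th: "0 < \<theta>" "\<theta> < pi" using m by (auto simp: \<theta>_def field_simps)
  then have sin: "sin \<theta> > 0" by (rule sin_gt_zero)
  have bilin: "bilin s r = - cos \<theta>"
    using bilin_sym[OF assms(1,2)] assms False by (simp add: bilin_def[of r s] m_def \<theta>_def)
  show ?thesis
  proof (rule that[of "\<lambda>k. sin (k * \<theta>) / sin \<theta>"])
    fix k :: nat
    have "sin (real (k + 2) * \<theta>) = 2 * cos \<theta> * sin (real (k + 1) * \<theta>) - sin (k * \<theta>)"
      using sin_step[of \<theta> "k * \<theta>"] by (simp add: algebra_simps)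
    then show "sin (real (k + 2) * \<theta>) / sin \<theta> = - 2 * bilin s r * (sin (real (k + 1) * \<theta>) / sin \<theta>) - sin (k * \<theta>) / sin \<theta>"
      using sin by (simp add: bilin field_simps)
    assume "ord (r \<otimes> s) = 0 \<or> k \<le> ord (r \<otimes> s)"
    then have "k * \<theta> \<le> pi" using False m by (auto simp: \<theta>_def m_def field_simps)
    then show "sin (k * \<theta>) / sin \<theta> \<ge> 0" using th sin by (simp add: sin_ge_zero)
  qed (use sin in auto)
qed

text \<open>Each further letter advances the pair of coefficients from \<open>c n, c (n + 1)\<close>
  to \<open>c (n + 1), c (n + 2)\<close>. Since \<open>c (k + 1)\<close> occurs, the bound on
  \<open>k\<close> is strict.\<close>

lemma dihedral_root_pos:
  assumes "s \<in> S" "r \<in> S" "s \<noteq> r" and k: "ord (r \<otimes> s) = 0 \<or> k < ord (r \<otimes> s)"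
  shows "\<exists>x\<ge>0. \<exists>y\<ge>0. act (inv (dih_elt r s (int k))) (alpha s) = lin_comb x (alpha s) y (alpha r)"
proof -
  obtain c :: "nat \<Rightarrow> real" where c: "c 0 = 0" "c 1 = 1"
    "\<And>k. c (k + 2) = - 2 * bilin s r * c (k + 1) - c k"
    "\<And>k. ord (r \<otimes> s) = 0 \<or> k \<le> ord (r \<otimes> s) \<Longrightarrow> c k \<ge> 0"
    using sin_ratio_sequence[OF assms(1-3)] by blast
  note inv = S_carrier[OF assms(2)] S_square[OF assms(2)] S_carrier[OF assms(1)] S_square[OF assms(1)]
  have "act (inv (dih_elt r s (int n))) (alpha s) =
      (if even n then lin_comb (c (n + 1)) (alpha s) (c n) (alpha r) else lin_comb (c n) (alpha s) (c (n + 1)) (alpha r))" for n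
  proof (induction n)
    case 0
    then show ?case using inv c by (auto simp: dih_elt_0 lin_comb_def)
  next
    case (Suc n)
    define x where "x = (if even (int n) then r else s)"
    have "dih_elt r s (int (Suc n)) = dih_elt r s (int n) \<otimes> x"
      using dih_elt_Suc[OF inv, of "int n"] by (simp add: x_def add.commute)
    moreover have "x \<in> S" using assms by (simp add: x_def)
    ultimately have "inv (dih_elt r s (int (Suc n))) = x \<otimes> inv (dih_elt r s (int n))"
      using inv by (simp add: dih_elt_closed inv_mult_group S_inv S_carrier)
    then have "act (inv (dih_elt r s (int (Suc n)))) (alpha s) = simple_refl x (act (inv (dih_elt r s (int n))) (alpha s))"
      using inv \<open>x \<in> S\<close> by (simp add: act_mult dih_elt_closed S_carrier act_S)
    also have "\<dots> = (if even n then lin_comb (c (n + 1)) (alpha s) (c (n + 2)) (alpha r)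
        else lin_comb (c (n + 2)) (alpha s) (c (n + 1)) (alpha r))"
      unfolding Suc.IH x_def using bilin_sym[OF assms(1,2)]
      by (simp add: simple_refl_alpha_comb1 simple_refl_alpha_comb2 c(3) del: add_2_eq_Suc' Suc_eq_plus1)
    finally show ?case by simp
  qed
  moreover have "c k \<ge> 0" "c (k + 1) \<ge> 0" using k c(4)[of k] c(4)[of "k + 1"] by auto
  ultimately show ?thesis by (cases "even k") auto
qed

lemma len_dih_elt:
  assumes "s \<in> S" "r \<in> S" shows "len (dih_elt r s k) \<le> nat \<bar>k\<bar>"
proof -
  note inv = S_carrier[OF assms(2)] S_square[OF assms(2)] S_carrier[OF assms(1)] S_square[OF assms(1)]
  have step: "len (w \<otimes> x) \<le> Suc (len w)" if "w \<in> carrier G" "x = s \<or> x = r" for w x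
    using len_mult_S[of w x] that assms by auto
  have up: "len (dih_elt r s (int n)) \<le> n" for n
  proof (induction n)
    case (Suc n)
    have "len (dih_elt r s (int n + 1)) \<le> Suc (len (dih_elt r s (int n)))"
      unfolding dih_elt_Suc[OF inv, of "int n", symmetric] by (rule step) (auto simp: dih_elt_closed[OF inv])
    then show ?case using Suc by (simp add: add.commute)
  qed (simp add: dih_elt_0[OF inv])
  have down: "len (dih_elt r s (- int n)) \<le> n" for n
  proof (induction n)
    case (Suc n)
    have "len (dih_elt r s (- int n - 1)) \<le> Suc (len (dih_elt r s (- int n)))"
      unfolding dih_elt_pred[OF inv, of "- int n", symmetric] by (rule step) (auto simp: dih_elt_closed[OF inv])
    moreover have "- int (Suc n) = - int n - 1" by simp
    ultimately show ?case using Suc by (simp only:)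
  qed (simp add: dih_elt_0[OF inv])
  show ?thesis using up[of "nat k"] down[of "nat (-k)"] by (cases "k \<ge> 0") auto
qed

subsection \<open>Positive roots and inversions\<close>

text \<open>Strip from \<open>w\<close> a longest alternating suffix in \<open>s\<close> and a right descent \<open>r\<close>. The remaining factor is
  shorter and has neither as a descent, and the suffix is too short for its dihedral root to be negative.\<close>

theorem ascent_root_pos:
  assumes "w \<in> carrier G" "s \<in> S" "len w < len (w \<otimes> s)"
  shows "nonneg (act w (alpha s))"
  using assms
proof (induction "len w" arbitrary: w s rule: less_induct)
  case less
  show ?case
  proof (cases "w = \<one>")
    case True
    then show ?thesis by (simp add: nonneg_alpha)
  next
    case False
    then obtain r where r: "r \<in> S" "len w = Suc (len (w \<otimes> r))"
      using right_descent less.prems by blast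
    then have "s \<noteq> r" using less.prems by auto
    note s = less.prems(2) and w = less.prems(1)
    note inv = S_carrier[OF r(1)] S_square[OF r(1)] S_carrier[OF s] S_square[OF s]
    \<comment> \<open>Each of the \<open>k\<close> letters, the first being \<open>r\<close>, lowers
      the length. \<open>good 1\<close> holds by the choice of \<open>r\<close>, so the greatest
      such \<open>k\<close> makes \<open>v\<close> shorter than \<open>w\<close> and the induction
      hypothesis applies to it.\<close>
    define good where "good k \<longleftrightarrow> len (w \<otimes> dih_elt r s (int k)) + k = len w" for k
    have "good 1" using r inv by (simp add: good_def dih_elt_1)
    moreover have bound: "k \<le> len w" if "good k" for k using that by (simp add: good_def)
    ultimately obtain k where k: "good k" "\<And>j. good j \<Longrightarrow> j \<le> k" "k \<ge> 1"
      using GreatestI_nat[of good 1 "len w"] Greatest_le_nat[of good _ "len w"] by metis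
    define v where "v = w \<otimes> dih_elt r s (int k)"
    have v: "v \<in> carrier G" using w inv by (simp add: v_def dih_elt_closed)
    have lv: "len v + k = len w" using k(1) by (simp add: good_def v_def)
    have "len v < len (v \<otimes> x)" if "x \<in> {r, s}" for x
    proof (cases "x = (if even (int k) then r else s)")
      case True
      have "v \<otimes> x = w \<otimes> dih_elt r s (int (Suc k))"
        using dih_elt_Suc[OF inv, of "int k"] w inv True
        by (auto simp: v_def m_assoc dih_elt_closed add.commute)
      moreover have "\<not> good (Suc k)" using k(2) by force
      ultimately have "Suc (len (v \<otimes> x)) \<noteq> len v" using lv by (simp add: good_def)
      then show ?thesis using len_mult_S[OF v, of x] that r s by auto
    next
      case False
      \<comment> \<open>Here \<open>x\<close> undoes the last letter stripped, so
        \<open>v \<otimes> x\<close> is only \<open>k - 1\<close> letters away from \<open>w\<close>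
        and cannot be shorter than \<open>v\<close>.\<close>
      then have "x = (if even (int k) then s else r)" using that by auto
      then have *: "v \<otimes> x = w \<otimes> dih_elt r s (int k - 1)"
        using dih_elt_pred[OF inv, of "int k"] w inv
        by (auto simp: v_def m_assoc dih_elt_closed add.commute)
      then have "w = (v \<otimes> x) \<otimes> inv (dih_elt r s (int k - 1))"
        using w inv by (simp add: m_assoc dih_elt_closed)
      then have "len w \<le> len (v \<otimes> x) + len (dih_elt r s (int k - 1))"
        using len_mult_le[of "v \<otimes> x" "inv (dih_elt r s (int k - 1))"] w inv
        by (simp add: * len_inv dih_elt_closed)
      then show ?thesis using len_dih_elt[OF s r(1), of "int k - 1"] lv k(3) by simp
    qed
    then have nonneg: "nonneg (act v (alpha s))" "nonneg (act v (alpha r))"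
      using less.hyps[of v] lv k(3) v r s by auto
    \<comment> \<open>Otherwise a shift by the period \<open>2 m\<close> turns the index
      \<open>-1 - k\<close> into one of absolute value at most \<open>k - 1\<close>, and
      \<open>w \<otimes> s\<close> would be shorter than \<open>w\<close>.\<close>
    have "ord (r \<otimes> s) = 0 \<or> k < ord (r \<otimes> s)"
    proof (rule ccontr)
      define m where "m = ord (r \<otimes> s)"
      assume "\<not> ?thesis"
      then have m: "m > 0" "m \<le> k" by (auto simp: m_def)
      have "w \<otimes> s = v \<otimes> inv (s \<otimes> dih_elt r s (int k))"
        using w inv by (simp add: v_def dih_elt_closed m_assoc inv_mult_group S_inv s)
      also have "s \<otimes> dih_elt r s (int k) = dih_elt r s (-1 - int k)"
        using mult_dih_elt(2)[OF inv] by simp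
      also have "\<dots> = dih_elt r s (-1 - int k + 2 * int m)"
        using dih_elt_period[OF inv] inv by (simp add: m_def pow_ord_eq_1)
      finally have "len (w \<otimes> s) \<le> len v + len (dih_elt r s (-1 - int k + 2 * int m))"
        using len_mult_le[OF v] by (metis dih_elt_closed inv inv_closed len_inv)
      also have "\<dots> \<le> len v + (k - 1)"
        using len_dih_elt[OF s r(1), of "-1 - int k + 2 * int m"] m by linarith
      finally show False using lv less.prems(3) k(3) by linarith
    qed
    then obtain x y where "x \<ge> 0" "y \<ge> 0"
        "act (inv (dih_elt r s (int k))) (alpha s) = lin_comb x (alpha s) y (alpha r)"
      using dihedral_root_pos[OF s r(1) \<open>s \<noteq> r\<close>] by blast
    moreover have "act w (alpha s) = act v (act (inv (dih_elt r s (int k))) (alpha s))"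
      using w inv by (simp add: v_def dih_elt_closed m_assoc flip: act_mult)
    ultimately show ?thesis using nonneg v by (simp add: act_lin_comb nonneg_lin_comb)
  qed
qed

definition neg_vec :: "('a + 'a \<Rightarrow> real) \<Rightarrow> 'a + 'a \<Rightarrow> real" where
  "neg_vec b = (\<lambda>i. - b i)"

lemma neg_vec_neg_vec [simp]: "neg_vec (neg_vec b) = b" by (simp add: neg_vec_def)

lemma act_neg_vec: "w \<in> carrier G \<Longrightarrow> act w (neg_vec b) = neg_vec (act w b)"
  using act_lin_comb[of w "-1" b 0 b] by (simp add: neg_vec_def lin_comb_def)

lemma act_S_alpha: "s \<in> S \<Longrightarrow> act s (alpha s) = neg_vec (alpha s)"
  by (auto simp: act_S simple_refl_def neg_vec_def)

lemma root_pos_or_neg: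
  assumes "b \<in> roots" shows "nonneg b \<or> nonneg (neg_vec b)"
proof -
  obtain w s where w: "b = act w (alpha s)" "w \<in> carrier G" "s \<in> S"
    using assms by (auto simp: roots_def)
  show ?thesis
  proof (cases "len w < len (w \<otimes> s)")
    case True
    then show ?thesis using ascent_root_pos w by simp
  next
    case False
    have "neg_vec b = act (w \<otimes> s) (alpha s)"
      using w S_carrier by (simp add: act_mult act_S_alpha act_neg_vec)
    moreover have "len (w \<otimes> s) < len (w \<otimes> s \<otimes> s)"
      using False len_mult_S[OF w(2,3)] w by (simp add: m_assoc S_carrier S_square)
    ultimately show ?thesis using ascent_root_pos[of "w \<otimes> s" s] w S_carrier by simp
  qed
qed

lemma root_not_pos_and_neg: "\<lbrakk>b \<in> roots; nonneg b\<rbrakk> \<Longrightarrow> \<not> nonneg (neg_vec b)"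
  by (erule root_nonzero) (auto simp: nonneg_def neg_vec_def intro: antisym)

lemma act_faithful:
  assumes "x \<in> carrier G" "y \<in> carrier G" "\<And>f. act x f = act y f" shows "x = y"
proof -
  define g where "g = inv y \<otimes> x"
  have g: "g \<in> carrier G" "\<And>f. act g f = f" using assms by (auto simp: g_def act_mult)
  have "g = \<one>"
  proof (rule ccontr)
    assume "g \<noteq> \<one>"
    then obtain s where s: "s \<in> S" "len g = Suc (len (g \<otimes> s))"
      using right_descent g by blast
    then have "nonneg (act (g \<otimes> s) (alpha s))"
      using g S_carrier by (intro ascent_root_pos) (auto simp: m_assoc S_square)
    then have "nonneg (neg_vec (alpha s))" using s g S_carrier by (simp add: act_mult act_S_alpha act_neg_vec)
    then show False using root_not_pos_and_neg alpha_roots nonneg_alpha s by blast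
  qed
  then have "y \<otimes> g = y" using assms by simp
  then show ?thesis using assms by (simp add: g_def)
qed

definition is_root_of :: "'a \<Rightarrow> ('a + 'a \<Rightarrow> real) \<Rightarrow> bool" where
  "is_root_of t b \<longleftrightarrow> (\<exists>w s. w \<in> carrier G \<and> s \<in> S \<and> t = w \<otimes> s \<otimes> inv w \<and> b = act w (alpha s))"

lemma is_root_of_roots: "is_root_of t b \<Longrightarrow> b \<in> roots"
  by (auto simp: is_root_of_def roots_def)

lemma is_root_of_T: "is_root_of t b \<Longrightarrow> t \<in> T"
  by (auto simp: is_root_of_def reflections_def)

lemma is_root_of_neg_vec: "is_root_of t b \<Longrightarrow> is_root_of t (neg_vec b)"
proof -
  assume "is_root_of t b"
  then obtain w s where w: "w \<in> carrier G" "s \<in> S" "t = w \<otimes> s \<otimes> inv w" "b = act w (alpha s)"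
    by (auto simp: is_root_of_def)
  have "t = (w \<otimes> s) \<otimes> s \<otimes> inv (w \<otimes> s)"
    using w S_carrier T_cancel[OF S_T] by (simp add: inv_mult_group S_inv m_assoc)
  moreover have "neg_vec b = act (w \<otimes> s) (alpha s)"
    using w S_carrier by (simp add: act_mult act_S_alpha act_neg_vec)
  ultimately show ?thesis using w S_carrier unfolding is_root_of_def by blast
qed

lemma is_root_of_act:
  assumes "is_root_of t b" "g \<in> carrier G" shows "is_root_of (g \<otimes> t \<otimes> inv g) (act g b)"
proof -
  obtain w s where w: "w \<in> carrier G" "s \<in> S" "t = w \<otimes> s \<otimes> inv w" "b = act w (alpha s)"
    using assms by (auto simp: is_root_of_def)
  then have "g \<otimes> t \<otimes> inv g = (g \<otimes> w) \<otimes> s \<otimes> inv (g \<otimes> w)" "act g b = act (g \<otimes> w) (alpha s)"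
    using assms S_carrier by (simp_all add: inv_mult_group m_assoc act_mult)
  then show ?thesis using w assms unfolding is_root_of_def by blast
qed

lemma is_root_of_reflection: "is_root_of t b \<Longrightarrow> act t f = lin_comb 1 f (- pairing b f) b"
  using act_reflection by (auto simp: is_root_of_def)

lemma is_root_of_proportional:
  assumes "is_root_of t b" "is_root_of t' b'" "\<And>y. b (Inr y) = x * b' (Inr y)"
  shows "t = t'"
proof (rule act_faithful)
  fix f
  note proportional = roots_proportional[OF is_root_of_roots[OF assms(1)] is_root_of_roots[OF assms(2)] assms(3)]
  have "act t f = lin_comb 1 f (- (x * pairing b' f)) b"
    using is_root_of_reflection[OF assms(1)] proportional(2) by simp
  also have "\<dots> = lin_comb 1 f (- (x * x * pairing b' f)) b'" by (auto simp: lin_comb_def proportional(1))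
  also have "x * x = 1" using proportional(3) by auto
  finally show "act t f = act t' f"
    using is_root_of_reflection[OF assms(2)] by simp
qed (use assms is_root_of_T T_carrier in auto)

lemma is_root_of_unique:
  assumes "is_root_of t b" "is_root_of t b'" shows "b' = b \<or> b' = neg_vec b"
proof -
  have "lin_comb 1 b (- pairing b b) b = lin_comb 1 b (- pairing b' b) b'"
    using is_root_of_reflection[OF assms(1)] is_root_of_reflection[OF assms(2)] by metis
  then have "2 * b i = pairing b' b * b' i" for i
    using pairing_self[OF is_root_of_roots[OF assms(1)]] by (auto simp: lin_comb_def fun_eq_iff)
  then have eq: "b i = (pairing b' b / 2) * b' i" for i by (simp add: field_simps)
  then have "pairing b' b / 2 = 1 \<or> pairing b' b / 2 = -1"
    using roots_proportional(3) assms is_root_of_roots by blast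
  then show ?thesis using eq by (auto simp: neg_vec_def fun_eq_iff)
qed

definition pos_root :: "'a \<Rightarrow> 'a + 'a \<Rightarrow> real" where
  "pos_root t = (SOME b. is_root_of t b \<and> nonneg b)"

lemma pos_root:
  assumes "t \<in> T" shows "is_root_of t (pos_root t)" "nonneg (pos_root t)"
proof -
  obtain w s where "w \<in> carrier G" "s \<in> S" "t = w \<otimes> s \<otimes> inv w"
    using assms by (auto simp: reflections_def)
  then have "is_root_of t (act w (alpha s))" unfolding is_root_of_def by blast
  then have "\<exists>b. is_root_of t b \<and> nonneg b"
    using is_root_of_neg_vec root_pos_or_neg is_root_of_roots by blast
  then show "is_root_of t (pos_root t)" "nonneg (pos_root t)"
    unfolding pos_root_def by (metis (mono_tags, lifting) someI_ex)+
qed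

lemma pos_root_roots: "t \<in> T \<Longrightarrow> pos_root t \<in> roots"
  using pos_root is_root_of_roots by blast

lemma pos_root_eqI: "\<lbrakk>is_root_of t b; nonneg b\<rbrakk> \<Longrightarrow> pos_root t = b"
  using pos_root is_root_of_unique is_root_of_T is_root_of_roots root_not_pos_and_neg by metis

lemma is_root_of_simple: "s \<in> S \<Longrightarrow> is_root_of s (alpha s)"
  unfolding is_root_of_def using S_carrier by (intro exI[of _ \<one>] exI[of _ s]) simp

lemma pos_root_simple: "s \<in> S \<Longrightarrow> pos_root s = alpha s"
  by (simp add: pos_root_eqI is_root_of_simple nonneg_alpha)

lemma pos_root_proportional:
  "\<lbrakk>t \<in> T; t' \<in> T; \<And>y. pos_root t (Inr y) = x * pos_root t' (Inr y)\<rbrakk> \<Longrightarrow> t = t'"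
  using is_root_of_proportional pos_root by blast

lemma act_pos_root_cases:
  assumes "t \<in> T" "g \<in> carrier G"
  shows "act g (pos_root t) = pos_root (g \<otimes> t \<otimes> inv g) \<or> act g (pos_root t) = neg_vec (pos_root (g \<otimes> t \<otimes> inv g))"
  using is_root_of_act[OF pos_root(1) assms(2)] is_root_of_unique pos_root T_conj assms by blast

text \<open>\<open>s\<close> changes only the coordinate at \<open>s\<close>. A positive root other
  than \<open>alpha s\<close> has another positive coordinate, which survives and decides the
  sign.\<close>

lemma simple_reflection_pos:
  assumes "s \<in> S" "t \<in> T" "t \<noteq> s"
  shows "nonneg (act s (pos_root t))"
proof -
  obtain y where y: "y \<noteq> s" "pos_root t (Inr y) \<noteq> 0"
  proof (rule ccontr)
    assume "\<not> thesis"
    then have "pos_root t (Inr y) = pos_root t (Inr s) * pos_root s (Inr y)" for y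
      using that \<open>s \<in> S\<close> by (cases "y = s") (auto simp: pos_root_simple)
    then show False using pos_root_proportional[of t s] assms S_T by blast
  qed
  have "act s (pos_root t) (Inr y) = pos_root t (Inr y)"
    using y assms by (simp add: act_S simple_refl_def)
  then have "act s (pos_root t) (Inr y) > 0"
    using y pos_root(2)[OF assms(2)] unfolding nonneg_def by (metis less_eq_real_def)
  then have "\<not> nonneg (neg_vec (act s (pos_root t)))" by (auto simp: nonneg_def neg_vec_def not_le)
  then show ?thesis
    using root_pos_or_neg roots_act pos_root_roots assms S_carrier by blast
qed

text \<open>Strong exchange by removing a left descent, \<open>w = s h\<close>. Either
  \<open>h\<close> already negates the root and induction applies, or \<open>h\<close> sends it to a
  positive root that \<open>s\<close> negates. This root must be \<open>alpha s\<close>, so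
  \<open>s h = h t\<close> and \<open>w \<otimes> t = h\<close>.\<close>

lemma exchange:
  assumes "w \<in> carrier G" "t \<in> T" "nonneg (neg_vec (act w (pos_root t)))"
  shows "len (w \<otimes> t) < len w"
  using assms
proof (induction "len w" arbitrary: w)
  case 0
  then have "w = \<one>" using len_eq_0 by simp
  then show ?case using 0 root_not_pos_and_neg pos_root pos_root_roots by auto
next
  case (Suc n)
  note w = Suc.prems(1) and t = \<open>t \<in> T\<close>
  have "w \<noteq> \<one>" using Suc.hyps(2) by auto
  then obtain s where s: "s \<in> S" "len w = Suc (len (s \<otimes> w))" using left_descent w by blast
  define h where "h = s \<otimes> w"
  have h: "h \<in> carrier G" "w = s \<otimes> h" using s w S_carrier T_cancel S_T by (auto simp: h_def)
  show ?case
  proof (cases "nonneg (neg_vec (act h (pos_root t)))")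
    case True
    then have "len (h \<otimes> t) < len h"
      using Suc.hyps s(2) by (intro Suc.hyps(1)) (simp_all add: h(1) t flip: h_def)
    moreover have "len (w \<otimes> t) \<le> Suc (len (h \<otimes> t))"
      using h s t S_len_mult[of "h \<otimes> t" s] by (auto simp: m_assoc T_carrier S_carrier)
    ultimately show ?thesis using s by (simp add: h_def)
  next
    case False
    define u where "u = h \<otimes> t \<otimes> inv h"
    have u: "u \<in> T" using h t T_conj by (simp add: u_def)
    have "act h (pos_root t) = pos_root u"
      using act_pos_root_cases[OF t h(1)] False pos_root(2)[OF u] by (auto simp: u_def)
    then have "nonneg (neg_vec (act s (pos_root u)))"
      using Suc.prems(3) h s by (simp add: act_mult S_carrier)
    moreover have "act s (pos_root u) \<in> roots" using roots_act pos_root_roots u s S_carrier by simp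
    ultimately have "u = s"
      using simple_reflection_pos[OF s(1) u] root_not_pos_and_neg by blast
    then have "w = h \<otimes> t" using h t by (auto simp: u_def m_assoc T_carrier)
    then have "w \<otimes> t = h" using h t by (simp add: m_assoc T_carrier T_square)
    then show ?thesis using s by (simp add: h_def)
  qed
qed

definition inverts :: "'a \<Rightarrow> 'a \<Rightarrow> bool" where
  "inverts w t \<longleftrightarrow> len (w \<otimes> t) < len w"

text \<open>One direction is \<open>exchange\<close>. The other is \<open>exchange\<close> for
  \<open>w \<otimes> t\<close>, whose sign on this root is opposite because \<open>t\<close> negates
  its own root.\<close>

lemma act_pos_root:
  assumes "t \<in> T" "w \<in> carrier G"
  shows "act w (pos_root t) = (if inverts w t then neg_vec (pos_root (w \<otimes> t \<otimes> inv w)) else pos_root (w \<otimes> t \<otimes> inv w))"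
proof -
  define u where "u = w \<otimes> t \<otimes> inv w"
  have u: "u \<in> T" using T_conj assms by (simp add: u_def)
  have "inverts w t" if "act w (pos_root t) = neg_vec (pos_root u)"
    using exchange assms that pos_root u by (simp add: inverts_def)
  moreover have "\<not> inverts w t" if "act w (pos_root t) = pos_root u"
  proof -
    have "act t (pos_root t) = lin_comb 1 (pos_root t) (-2) (pos_root t)"
      using is_root_of_reflection[OF pos_root(1)] pairing_self pos_root_roots assms by simp
    also have "\<dots> = neg_vec (pos_root t)" by (auto simp: lin_comb_def neg_vec_def)
    finally have "act (w \<otimes> t) (pos_root t) = neg_vec (pos_root u)"
      using assms that by (simp add: act_mult T_carrier act_neg_vec)
    then have "len (w \<otimes> t \<otimes> t) < len (w \<otimes> t)"
      using exchange assms pos_root u by (simp add: T_carrier)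
    then show ?thesis using assms by (simp add: inverts_def m_assoc T_carrier T_square)
  qed
  ultimately show ?thesis using act_pos_root_cases[OF assms] by (auto simp: u_def)
qed

lemma inverts_iff: "\<lbrakk>w \<in> carrier G; t \<in> T\<rbrakk> \<Longrightarrow> inverts w t \<longleftrightarrow> \<not> nonneg (act w (pos_root t))"
  using act_pos_root[of t w] pos_root[of "w \<otimes> t \<otimes> inv w"] T_conj root_not_pos_and_neg pos_root_roots neg_vec_neg_vec by auto

text \<open>The cocycle rule for inversion sets: the sign under \<open>g \<otimes> h\<close> is the
  product of the sign under \<open>h\<close> and the sign under \<open>g\<close> of the image
  root.\<close>

lemma inverts_mult:
  assumes "g \<in> carrier G" "h \<in> carrier G" "t \<in> T"
  shows "inverts (g \<otimes> h) t \<longleftrightarrow> (inverts g (h \<otimes> t \<otimes> inv h) \<noteq> inverts h t)"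
proof -
  define u where "u = h \<otimes> t \<otimes> inv h"
  have u: "u \<in> T" using T_conj assms by (simp add: u_def)
  have r: "act g (pos_root u) \<in> roots" using u assms roots_act pos_root_roots by blast
  have "act (g \<otimes> h) (pos_root t) = (if inverts h t then neg_vec (act g (pos_root u)) else act g (pos_root u))"
    using assms act_pos_root[of t h] by (auto simp: act_mult act_neg_vec u_def)
  then show ?thesis
    using inverts_iff[of "g \<otimes> h" t] inverts_iff[of g u] assms u r root_pos_or_neg root_not_pos_and_neg
    by (auto simp flip: u_def split: if_splits)
qed

lemma inverts_self: "t \<in> T \<Longrightarrow> inverts t t"
  using odd_len_T[of t] odd_pos[of "len t"] by (auto simp: inverts_def T_square)

lemma not_inverts_one: "t \<in> T \<Longrightarrow> \<not> inverts \<one> t"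
  by (simp add: inverts_def)

lemma inverts_simple: "\<lbrakk>s \<in> S; t \<in> T\<rbrakk> \<Longrightarrow> inverts s t \<longleftrightarrow> t = s"
  using inverts_iff[of s t] simple_reflection_pos inverts_self S_carrier S_T by auto

lemma not_inverts: "\<lbrakk>w \<in> carrier G; t \<in> T\<rbrakk> \<Longrightarrow> \<not> inverts w t \<longleftrightarrow> len w < len (w \<otimes> t)"
  using len_mult_T_neq[of w t] by (auto simp: inverts_def)

subsection \<open>Reflections in a plane\<close>

text \<open>All reflections with roots in the span are taken, not only those of the subgroup
  generated by \<open>a\<close> and \<open>b\<close>; this makes \<open>plane_product\<close>
  hold.\<close>

definition plane :: "'a \<Rightarrow> 'a \<Rightarrow> 'a set" where
  "plane a b = {t \<in> T. \<exists>x y. pos_root t = lin_comb x (pos_root a) y (pos_root b)}"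

lemma planeI: "\<lbrakk>t \<in> T; \<And>i. pos_root t i = x * pos_root a i + y * pos_root b i\<rbrakk> \<Longrightarrow> t \<in> plane a b"
  unfolding plane_def lin_comb_def by blast

lemma planeE:
  assumes "t \<in> plane a b"
  obtains x y where "t \<in> T" "\<And>i. pos_root t i = x * pos_root a i + y * pos_root b i"
  using assms unfolding plane_def lin_comb_def by (auto simp: fun_eq_iff)

lemma plane_T: "t \<in> plane a b \<Longrightarrow> t \<in> T"
  by (simp add: plane_def)

lemma plane_generators:
  assumes "a \<in> T" "b \<in> T" shows "a \<in> plane a b" "b \<in> plane a b"
  using planeI[of a 1 a 0 b] planeI[of b 0 a 1 b] assms by auto

lemma act_T: "t \<in> T \<Longrightarrow> act t f i = f i - pairing (pos_root t) f * pos_root t i"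
  using is_root_of_reflection[OF pos_root(1)] by (simp add: lin_comb_def)

lemma act_pos_root_sign:
  assumes "t \<in> T" "w \<in> carrier G"
  obtains e where "e = 1 \<or> e = (-1::real)" "\<And>i. pos_root (w \<otimes> t \<otimes> inv w) i = e * act w (pos_root t) i"
  using act_pos_root_cases[OF assms] that[of 1] that[of "-1"] by (auto simp: neg_vec_def)

lemma plane_conj:
  assumes "t \<in> plane a b" "u \<in> plane a b" shows "t \<otimes> u \<otimes> t \<in> plane a b"
proof -
  obtain x y where t: "t \<in> T" "\<And>i. pos_root t i = x * pos_root a i + y * pos_root b i" using planeE[OF assms(1)] by blast
  obtain v w where u: "u \<in> T" "\<And>i. pos_root u i = v * pos_root a i + w * pos_root b i" using planeE[OF assms(2)] by blast
  obtain e where e: "\<And>i. pos_root (t \<otimes> u \<otimes> inv t) i = e * act t (pos_root u) i"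
    using act_pos_root_sign[OF u(1) T_carrier[OF t(1)]] by blast
  define k where "k = pairing (pos_root t) (pos_root u)"
  show ?thesis
  proof (rule planeI[where x = "e * (v - k * x)" and y = "e * (w - k * y)"])
    show "t \<otimes> u \<otimes> t \<in> T" using T_conj[OF u(1) T_carrier[OF t(1)]] T_inv[OF t(1)] by simp
    show "pos_root (t \<otimes> u \<otimes> t) i = e * (v - k * x) * pos_root a i + e * (w - k * y) * pos_root b i" for i
      using e[of i] act_T[OF t(1), of "pos_root u" i] t u by (simp add: T_inv k_def algebra_simps)
  qed
qed

text \<open>If the kernel of one functional contained that of the other, they would be proportional.
  Unit vectors at \<open>Inl y\<close>, available because pairings are coordinates of their own,
  would then make the roots proportional.\<close>

lemma pairing_independent:
  assumes "c \<in> T" "d \<in> T" "c \<noteq> d"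
  obtains f where "pairing (pos_root c) f = 1" "pairing (pos_root d) f = 0"
proof -
  have "\<exists>f. pairing (pos_root d) f = 0 \<and> pairing (pos_root c) f \<noteq> 0"
  proof (rule ccontr)
    assume "\<not> ?thesis"
    then have ker: "pairing (pos_root c) f = 0" if "pairing (pos_root d) f = 0" for f using that by blast
    define k where "k = pairing (pos_root c) (pos_root d) / 2"
    have "pairing (pos_root d) (lin_comb 1 f (- pairing (pos_root d) f / 2) (pos_root d)) = 0" for f
      using pairing_self[OF pos_root_roots[OF assms(2)]] by (simp add: pairing_lin_comb)
    then have "pairing (pos_root c) (lin_comb 1 f (- pairing (pos_root d) f / 2) (pos_root d)) = 0" for f using ker by blast
    then have proportional: "pairing (pos_root c) f = k * pairing (pos_root d) f" for f
      by (simp add: pairing_lin_comb k_def)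
    have coord: "pairing (pos_root t) (\<lambda>i. if i = Inl y then 1 else 0) = pos_root t (Inr y)" if "t \<in> T" for t y
    proof -
      have "finite {x. pos_root t (Inr x) \<noteq> 0}"
        using pos_root_roots[OF that] root_expansion(1) by (auto simp: roots_def)
      moreover have "pairing (pos_root t) (\<lambda>i. if i = Inl y then 1 else 0) =
          (\<Sum>x | pos_root t (Inr x) \<noteq> 0. if x = y then pos_root t (Inr x) else 0)"
        unfolding pairing_def by (rule sum.cong) auto
      ultimately show ?thesis by simp
    qed
    have "pos_root c (Inr y) = k * pos_root d (Inr y)" for y
      using proportional[of "\<lambda>i. if i = Inl y then 1 else 0"] coord assms by simp
    then show False using pos_root_proportional assms by blast
  qed
  then obtain f where f: "pairing (pos_root d) f = 0" "pairing (pos_root c) f \<noteq> 0" by blast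
  show ?thesis
    using that[of "lin_comb (1 / pairing (pos_root c) f) f 0 f"] f by (simp add: pairing_lin_comb)
qed

text \<open>The roots of \<open>t\<close> and \<open>u\<close> span the image of \<open>t u - 1\<close>, so the product determines their plane.\<close>

lemma plane_product_fst:
  assumes "t \<in> plane a b" "u \<in> plane a b" "t \<noteq> u" "c \<in> T" "d \<in> T" "t \<otimes> u = c \<otimes> d"
  shows "c \<in> plane a b"
proof -
  obtain x y where t: "t \<in> T" "\<And>i. pos_root t i = x * pos_root a i + y * pos_root b i" using planeE[OF assms(1)] by blast
  obtain v w where u: "u \<in> T" "\<And>i. pos_root u i = v * pos_root a i + w * pos_root b i" using planeE[OF assms(2)] by blast
  have "c \<noteq> d"
  proof
    assume "c = d"
    then have "t \<otimes> (t \<otimes> u) = t" using assms T_square T_carrier t by simp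
    then show False using T_cancel[of t u] t u T_carrier assms by simp
  qed
  \<comment> \<open>On this \<open>f\<close>, \<open>d\<close> acts trivially and \<open>c\<close>
    subtracts exactly its root, so \<open>f\<close> minus its image is \<open>pos_root c\<close>;
    computed with \<open>t \<otimes> u\<close>, the difference lies in the plane.\<close>
  then obtain f where f: "pairing (pos_root c) f = 1" "pairing (pos_root d) f = 0"
    using pairing_independent assms by blast
  have "act (c \<otimes> d) f i = f i - pos_root c i" for i
  proof -
    have "act d f = f" using act_T[of d f] f assms by auto
    then show ?thesis using f assms by (simp add: act_mult T_carrier act_T)
  qed
  moreover have "act (t \<otimes> u) f i = f i - pairing (pos_root u) f * pos_root u i - pairing (pos_root t) (act u f) * pos_root t i" for i
    using t u by (simp add: act_mult T_carrier act_T)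
  ultimately have "pos_root c i = pairing (pos_root u) f * pos_root u i + pairing (pos_root t) (act u f) * pos_root t i" for i
    unfolding assms(6) by (smt (verit, best))
  then have "pos_root c i = (pairing (pos_root u) f * v + pairing (pos_root t) (act u f) * x) * pos_root a i
      + (pairing (pos_root u) f * w + pairing (pos_root t) (act u f) * y) * pos_root b i" for i
    by (simp add: t u algebra_simps)
  then show ?thesis using planeI assms(4) by blast
qed

lemma plane_product:
  assumes "t \<in> plane a b" "u \<in> plane a b" "t \<noteq> u" "c \<in> T" "d \<in> T" "t \<otimes> u = c \<otimes> d"
  shows "c \<in> plane a b" "d \<in> plane a b"
proof -
  show "c \<in> plane a b" using plane_product_fst[OF assms] .
  have "inv (t \<otimes> u) = inv (c \<otimes> d)" using assms by simp
  then have "u \<otimes> t = d \<otimes> c"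
    using assms(1,2)[THEN plane_T] assms(4,5) by (simp add: inv_mult_group T_carrier T_inv plane_T)
  then show "d \<in> plane a b" using plane_product_fst[of u a b t d c] assms by auto
qed

text \<open>Dyer's canonical generators of the dihedral group of the plane: they behave in the plane
  as simple reflections do in \<open>T\<close> by \<open>inverts_simple\<close>.\<close>

definition extreme :: "'a \<Rightarrow> 'a \<Rightarrow> 'a set" where
  "extreme a b = {t \<in> plane a b. \<forall>u\<in>plane a b. inverts t u \<longrightarrow> u = t}"

text \<open>Passing from \<open>h\<close> to \<open>w = s h\<close> adds one inversion, the
  conjugate of \<open>s\<close> by \<open>inv h\<close>, and removes none. So if \<open>h\<close>
  inverts something in the plane, induction applies; otherwise \<open>t\<close> is the first
  inversion in the plane and \<open>w = h t\<close>, and the cocycle rule shows that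
  \<open>t\<close> inverts nothing else there.\<close>

lemma extreme_exists:
  assumes "w \<in> carrier G" "t \<in> plane a b" "inverts w t"
  shows "\<exists>d\<in>extreme a b. inverts w d"
  using assms
proof (induction "len w" arbitrary: w t)
  case 0
  then show ?case by (simp add: inverts_def)
next
  case (Suc n)
  note w = \<open>w \<in> carrier G\<close>
  have "w \<noteq> \<one>" using Suc.hyps(2) by auto
  then obtain s where s: "s \<in> S" "len w = Suc (len (s \<otimes> w))" using left_descent w by blast
  define h where "h = s \<otimes> w"
  have h: "h \<in> carrier G" "w = s \<otimes> h" using s w S_carrier T_cancel S_T by (auto simp: h_def)
  have inverts_w: "inverts w u \<longleftrightarrow> (h \<otimes> u \<otimes> inv h = s) \<noteq> inverts h u" if "u \<in> plane a b" for u
    using inverts_mult[of s h u] inverts_simple[of s] T_conj[of u h] that plane_T h s S_carrier by auto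
  show ?case
  proof (cases "\<exists>u\<in>plane a b. inverts h u")
    case True
    then obtain d where d: "d \<in> extreme a b" "inverts h d"
      using Suc.hyps s(2) h(1) unfolding h_def by (metis Suc_inject)
    then have "d \<in> plane a b" by (simp add: extreme_def)
    have "h \<otimes> d \<otimes> inv h \<noteq> s"
    proof
      assume "h \<otimes> d \<otimes> inv h = s"
      then have "w = h \<otimes> d" using h \<open>d \<in> plane a b\<close> plane_T T_carrier by (auto simp: m_assoc)
      then show False using d(2) s(2) by (simp add: inverts_def h_def)
    qed
    then show ?thesis using inverts_w[OF \<open>d \<in> plane a b\<close>] d by blast
  next
    case False
    then have conj: "h \<otimes> t \<otimes> inv h = s" using inverts_w Suc.prems by blast
    note t = plane_T[OF \<open>t \<in> plane a b\<close>] T_carrier[OF plane_T[OF \<open>t \<in> plane a b\<close>]]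
    have ht: "h \<otimes> t = w" using h t by (simp add: m_assoc flip: conj)
    have "u = t" if u: "u \<in> plane a b" "inverts t u" for u
    proof (rule ccontr)
      assume "u \<noteq> t"
      note uT = plane_T[OF u(1)]
      have "h \<otimes> u \<otimes> inv h \<noteq> s"
      proof
        assume "h \<otimes> u \<otimes> inv h = s"
        then have "inv h \<otimes> (h \<otimes> u \<otimes> inv h) \<otimes> h = inv h \<otimes> (h \<otimes> t \<otimes> inv h) \<otimes> h" using conj by simp
        then show False using h t uT \<open>u \<noteq> t\<close> T_carrier by (simp add: m_assoc)
      qed
      then have "\<not> inverts w u" using inverts_w u False by blast
      moreover have "inverts w u \<longleftrightarrow> (inverts h (t \<otimes> u \<otimes> t) \<noteq> inverts t u)"
        using inverts_mult[of h t u] ht h t uT by (simp add: T_inv)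
      ultimately show False using u False plane_conj Suc.prems(2) by blast
    qed
    then have "t \<in> extreme a b" using Suc.prems by (auto simp: extreme_def)
    then show ?thesis using Suc.prems by blast
  qed
qed

text \<open>If an element inverts a root of the plane but not the canonical one already found, the first
  root of the plane that it inverts is a second canonical one.\<close>

lemma two_extreme:
  assumes "a \<in> T" "b \<in> T" "a \<noteq> b"
  obtains p q where "p \<in> extreme a b" "q \<in> extreme a b" "p \<noteq> q"
proof -
  obtain p where p: "p \<in> extreme a b"
    using extreme_exists[of a a] plane_generators[OF assms(1,2)] inverts_self T_carrier assms by blast
  then have pp: "p \<in> plane a b" "p \<in> T" by (auto simp: extreme_def plane_T)
  obtain c where c: "c \<in> plane a b" "c \<noteq> p"
    using plane_generators[OF assms(1,2)] assms(3) by metis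
  then have cT: "c \<in> T" by (simp add: plane_T)
  \<comment> \<open>\<open>c\<close> serves unless it inverts \<open>p\<close>. In that case
    \<open>c \<otimes> p\<close> no longer inverts \<open>p\<close>, while it inverts
    \<open>p \<otimes> c \<otimes> p\<close> because \<open>p\<close> does not.\<close>
  have "\<exists>w\<in>carrier G. \<not> inverts w p \<and> (\<exists>u\<in>plane a b. inverts w u)"
  proof (cases "inverts c p")
    case False
    then show ?thesis using c cT inverts_self T_carrier by blast
  next
    case True
    have "p \<otimes> c \<otimes> p \<noteq> p"
    proof
      assume "p \<otimes> c \<otimes> p = p"
      then have "p \<otimes> (p \<otimes> c \<otimes> p) \<otimes> p = p \<otimes> p \<otimes> p" by simp
      then show False using pp cT c T_carrier by (simp add: m_assoc T_cancel T_square)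
    qed
    moreover have pc: "p \<otimes> c \<otimes> p \<in> plane a b" using pp c plane_conj by blast
    ultimately have "\<not> inverts p (p \<otimes> c \<otimes> p)" using p by (auto simp: extreme_def)
    moreover have "p \<otimes> (p \<otimes> c \<otimes> p) \<otimes> p = c"
      using pp cT T_carrier by (simp add: m_assoc T_cancel T_square)
    moreover have "inverts (c \<otimes> p) (p \<otimes> c \<otimes> p) \<longleftrightarrow> (inverts c (p \<otimes> (p \<otimes> c \<otimes> p) \<otimes> p) \<noteq> inverts p (p \<otimes> c \<otimes> p))"
      using inverts_mult[of c p "p \<otimes> c \<otimes> p"] cT pp T_carrier plane_T[OF pc] by (simp add: T_inv)
    ultimately have "inverts (c \<otimes> p) (p \<otimes> c \<otimes> p)" using inverts_self cT by simp
    moreover have "\<not> inverts (c \<otimes> p) p"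
      using inverts_mult[of c p p] cT pp T_carrier True inverts_self by (simp add: T_inv T_square)
    ultimately show ?thesis using pc cT pp T_carrier by blast
  qed
  then obtain q where "q \<in> extreme a b" "q \<noteq> p" using extreme_exists by metis
  then show ?thesis using that p by blast
qed

subsection \<open>Canonical generators of a plane\<close>

lemma extremeD:
  assumes "p \<in> extreme a b" shows "p \<in> plane a b" "p \<in> T" "p \<in> carrier G" "p \<otimes> p = \<one>"
  using assms plane_T T_carrier T_square by (auto simp: extreme_def)

text \<open>\<open>p\<close> keeps all other positive roots of the plane positive and negates its
  own, so its root spans an extreme ray of their cone.\<close>

lemma extreme_not_combination:
  assumes p: "p \<in> extreme a b" and "t \<in> plane a b" "u \<in> plane a b" "t \<noteq> p" "u \<noteq> p"
    and "x \<ge> 0" "y \<ge> 0" "\<And>i. pos_root p i = x * pos_root t i + y * pos_root u i"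
  shows False
proof -
  note pT = extremeD[OF p]
  have *: "nonneg (act p (pos_root v))" if "v \<in> plane a b" "v \<noteq> p" for v
    using that p inverts_iff[of p v] pT plane_T by (auto simp: extreme_def)
  have "pos_root p = lin_comb x (pos_root t) y (pos_root u)" using assms by (auto simp: lin_comb_def)
  then have "act p (pos_root p) = lin_comb x (act p (pos_root t)) y (act p (pos_root u))"
    using pT by (metis act_lin_comb)
  then have "nonneg (act p (pos_root p))" using * assms by (simp add: nonneg_lin_comb)
  then show False using inverts_iff[of p p] inverts_self pT by blast
qed

context
  fixes a b p q
  assumes a: "a \<in> T" and b: "b \<in> T"
    and p: "p \<in> extreme a b" and q: "q \<in> extreme a b" and pq: "p \<noteq> q"
begin

lemma extreme_pos_root_not_proportional: "\<not> (\<forall>i. x * pos_root p i = y * pos_root q i)" if "x \<noteq> 0 \<or> y \<noteq> 0"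
proof
  assume eq: "\<forall>i. x * pos_root p i = y * pos_root q i"
  note pT = extremeD(2)[OF p] extremeD(2)[OF q]
  have "x \<noteq> 0"
  proof
    assume "x = 0"
    then have "\<forall>i. pos_root q i = 0" using eq that by auto
    then show False using root_nonzero[OF pos_root_roots[OF pT(2)]] by metis
  qed
  then have "pos_root p (Inr i) = y / x * pos_root q (Inr i)" for i using eq by (simp add: field_simps)
  then show False using pos_root_proportional pT pq by blast
qed

text \<open>Solve for the coordinates of the root of \<open>t\<close> by Cramer's rule. Two negative
  coordinates contradict positivity; with opposite signs, \<open>p\<close> or \<open>q\<close> would
  be a nonnegative combination of two other roots.\<close>

lemma extreme_generate_cone:
  assumes "t \<in> plane a b"
  shows "\<exists>x\<ge>0. \<exists>y\<ge>0. \<forall>i. pos_root t i = x * pos_root p i + y * pos_root q i"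
proof -
  note pP = extremeD[OF p] and qP = extremeD[OF q]
  note tT = plane_T[OF assms]
  obtain x1 y1 where p1: "\<And>i. pos_root p i = x1 * pos_root a i + y1 * pos_root b i" using planeE[OF pP(1)] by blast
  obtain x2 y2 where q1: "\<And>i. pos_root q i = x2 * pos_root a i + y2 * pos_root b i" using planeE[OF qP(1)] by blast
  obtain x3 y3 where t1: "\<And>i. pos_root t i = x3 * pos_root a i + y3 * pos_root b i" using planeE[OF assms] by blast
  define D where "D = x1 * y2 - x2 * y1"
  have "D \<noteq> 0"
  proof
    assume "D = 0"
    have "y2 * pos_root p i - y1 * pos_root q i = D * pos_root a i" "x2 * pos_root p i - x1 * pos_root q i = - D * pos_root b i" for i
      unfolding p1 q1 D_def by (simp_all add: algebra_simps)
    then have "y2 * pos_root p i = y1 * pos_root q i" "x2 * pos_root p i = x1 * pos_root q i" for i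
      using \<open>D = 0\<close> by simp_all
    then have "x1 = 0" "y1 = 0"
      using extreme_pos_root_not_proportional[of y2 y1] extreme_pos_root_not_proportional[of x2 x1] by blast+
    then have "pos_root p i = 0" for i using p1 by simp
    then show False using root_nonzero[OF pos_root_roots[OF pP(2)]] by metis
  qed
  define x where "x = (x3 * y2 - y3 * x2) / D"
  define y where "y = (y3 * x1 - x3 * y1) / D"
  have t: "pos_root t i = x * pos_root p i + y * pos_root q i" for i
  proof -
    have "D * (x * pos_root p i + y * pos_root q i) = (x3 * y2 - y3 * x2) * pos_root p i + (y3 * x1 - x3 * y1) * pos_root q i"
      using \<open>D \<noteq> 0\<close> by (simp add: x_def y_def field_simps)
    also have "\<dots> = D * pos_root t i" unfolding p1 q1 t1 D_def by (simp add: algebra_simps)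
    finally show ?thesis using \<open>D \<noteq> 0\<close> by simp
  qed
  show ?thesis
  proof (cases "t = p \<or> t = q")
    case True
    then show ?thesis
    proof
      assume "t = p"
      then show ?thesis by (intro exI[of _ 1] exI[of _ 0] conjI) auto
    next
      assume "t = q"
      then show ?thesis by (intro exI[of _ 0] exI[of _ 1] conjI) auto
    qed
  next
    case False
    have "x \<ge> 0 \<or> y \<ge> 0"
    proof (rule ccontr)
      assume neg: "\<not> ?thesis"
      have "neg_vec (pos_root t) = lin_comb (-x) (pos_root p) (-y) (pos_root q)"
        by (auto simp: neg_vec_def lin_comb_def t)
      then have "nonneg (neg_vec (pos_root t))" using neg pos_root(2) pP qP by (simp add: nonneg_lin_comb)
      then show False using root_not_pos_and_neg pos_root_roots pos_root(2) tT by blast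
    qed
    moreover have "\<not> (x < 0 \<and> y \<ge> 0)"
    proof
      assume xy: "x < 0 \<and> y \<ge> 0"
      have "y \<noteq> 0"
      proof
        assume "y = 0"
        then have "pos_root t (Inr i) = x * pos_root p (Inr i)" for i using t by simp
        then show False using pos_root_proportional[OF tT pP(2)] False by blast
      qed
      then have "pos_root q i = (1 / y) * pos_root t i + (- x / y) * pos_root p i" for i
        using t[of i] by (simp add: field_simps)
      moreover have "1 / y \<ge> 0" "- x / y \<ge> 0" using xy by (simp_all add: divide_nonpos_nonneg)
      ultimately show False
        using extreme_not_combination[OF q assms pP(1), of "1 / y" "- x / y"] False pq by blast
    qed
    moreover have "\<not> (y < 0 \<and> x \<ge> 0)"
    proof
      assume xy: "y < 0 \<and> x \<ge> 0"
      have "x \<noteq> 0"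
      proof
        assume "x = 0"
        then have "pos_root t (Inr i) = y * pos_root q (Inr i)" for i using t by simp
        then show False using pos_root_proportional[OF tT qP(2)] False by blast
      qed
      then have "pos_root p i = (1 / x) * pos_root t i + (- y / x) * pos_root q i" for i
        using t[of i] by (simp add: field_simps)
      moreover have "1 / x \<ge> 0" "- y / x \<ge> 0" using xy by (simp_all add: divide_nonpos_nonneg)
      ultimately show False
        using extreme_not_combination[OF p assms qP(1), of "1 / x" "- y / x"] False pq by blast
    qed
    ultimately show ?thesis using t by (metis linorder_not_le)
  qed
qed

end

text \<open>A positive pairing makes the \<open>q\<close>-coefficient of the image of the root of
  \<open>p\<close> under \<open>t\<close> negative, so \<open>t\<close> inverts \<open>p\<close>. As
  \<open>p\<close> is extreme and \<open>t p t\<close> differs from \<open>p\<close>,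
  \<open>p t\<close> inverts \<open>p\<close> as well. Both inequalities combine because
  \<open>p t\<close> and \<open>t p\<close> are inverse to each other.\<close>

lemma extreme_descent:
  assumes "a \<in> T" "b \<in> T" and p: "p \<in> extreme a b" and q: "q \<in> extreme a b" and "p \<noteq> q"
    and t: "t \<in> plane a b" "t \<noteq> p" and xy: "\<And>i. pos_root t i = x * pos_root p i + y * pos_root q i" "y > 0"
    and pos_pairing: "pairing (pos_root t) (pos_root p) > 0"
  shows "len (p \<otimes> t \<otimes> p) < len t"
proof -
  note pP = extremeD[OF p] and qP = extremeD[OF q]
  note tT = plane_T[OF t(1)] T_carrier[OF plane_T[OF t(1)]]
  define B where "B = pairing (pos_root t) (pos_root p)"
  have act: "act t (pos_root p) i = (1 - B * x) * pos_root p i - B * y * pos_root q i" for i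
    using act_T[OF tT(1), of "pos_root p" i] xy(1)[of i] by (simp add: B_def algebra_simps)
  have tpt: "t \<otimes> p \<otimes> t \<in> plane a b" using plane_conj t pP by blast
  have inverts: "inverts t p"
  proof (rule ccontr)
    assume "\<not> inverts t p"
    then have "act t (pos_root p) = pos_root (t \<otimes> p \<otimes> t)"
      using act_pos_root[of p t] pP tT by (simp add: T_inv)
    moreover obtain x' y' where "y' \<ge> 0" "\<And>i. pos_root (t \<otimes> p \<otimes> t) i = x' * pos_root p i + y' * pos_root q i"
      using extreme_generate_cone[OF assms(1-5) tpt] by blast
    ultimately have "(1 - B * x - x') * pos_root p i = (y' + B * y) * pos_root q i" for i
      using act[of i] by (simp add: algebra_simps)
    moreover have "y' + B * y > 0" using \<open>y' \<ge> 0\<close> xy(2) pos_pairing by (simp add: B_def add_nonneg_pos)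
    ultimately show False using extreme_pos_root_not_proportional[OF assms(1-5)] by (metis less_irrefl)
  qed
  have "t \<otimes> p \<otimes> t \<noteq> p"
  proof
    assume "t \<otimes> p \<otimes> t = p"
    then have "act t (pos_root p) = neg_vec (pos_root p)"
      using act_pos_root[of p t] pP tT inverts by (simp add: T_inv)
    then have "B * pos_root t i = 2 * pos_root p i" for i
      using act_T[OF tT(1), of "pos_root p" i] by (simp add: neg_vec_def B_def)
    then have "pos_root t (Inr i) = (2 / B) * pos_root p (Inr i)" for i
      using pos_pairing by (simp add: B_def field_simps)
    then show False using pos_root_proportional[OF tT(1) pP(2)] t by blast
  qed
  then have "\<not> inverts p (t \<otimes> p \<otimes> t)" using p tpt by (auto simp: extreme_def)
  then have "inverts (p \<otimes> t) p" using inverts_mult[of p t p] pP tT inverts by (simp add: T_inv)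
  then have "len (p \<otimes> t \<otimes> p) < len (p \<otimes> t)" by (simp add: inverts_def)
  also have "len (p \<otimes> t) = len (t \<otimes> p)"
    using len_inv[of "t \<otimes> p"] pP tT by (simp add: inv_mult_group T_inv)
  also have "\<dots> < len t" using inverts by (simp add: inverts_def)
  finally show ?thesis .
qed

context
  fixes a b p q
  assumes a: "a \<in> T" and b: "b \<in> T"
    and p: "p \<in> extreme a b" and q: "q \<in> extreme a b" and pq: "p \<noteq> q"
begin

lemmas pP = extremeD[OF p] and qP = extremeD[OF q]
lemmas invols = extremeD(3,4)[OF p] extremeD(3,4)[OF q]
lemmas dih_elt_rules = dih_elt_closed[OF invols] dih_elt_mult_even[OF invols] dih_elt_mult_odd[OF invols] dih_elt_inv[OF invols]
  dih_elt_0[OF invols]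

lemma dih_elt_conj: "p \<otimes> dih_elt p q k \<otimes> p = dih_elt p q (2 - k)" "q \<otimes> dih_elt p q k \<otimes> q = dih_elt p q (-2 - k)" if "odd k"
  using that dih_elt_Suc[OF invols, of "1 - k"] dih_elt_pred[OF invols, of "-1 - k"] mult_dih_elt[OF invols]
  by simp_all

text \<open>Since \<open>2\<close> is the pairing of the root of \<open>t\<close> with itself and
  the coordinates are nonnegative, its pairing with the root of \<open>p\<close> or \<open>q\<close>
  is positive. Conjugation by that generator shortens \<open>t\<close>.\<close>

lemma plane_subset_dih_elt: "t \<in> plane a b \<Longrightarrow> \<exists>k. odd k \<and> t = dih_elt p q k"
proof (induction "len t" arbitrary: t rule: less_induct)
  case less
  note t = plane_T[OF less.prems] T_carrier[OF plane_T[OF less.prems]]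
  show ?case
  proof (cases "t = p \<or> t = q")
    case True
    then show ?thesis
    proof
      assume "t = p"
      then show ?thesis using dih_elt_1[OF invols] by (intro exI[of _ 1]) simp
    next
      assume "t = q"
      then show ?thesis using dih_elt_m1[OF invols] by (intro exI[of _ "-1"]) simp
    qed
  next
    case False
    obtain x y where xy: "x \<ge> 0" "y \<ge> 0" "\<And>i. pos_root t i = x * pos_root p i + y * pos_root q i"
      using extreme_generate_cone[OF a b p q pq less.prems] by blast
    have "x \<noteq> 0"
    proof
      assume "x = 0"
      then have "pos_root t (Inr i) = y * pos_root q (Inr i)" for i using xy by simp
      then show False using pos_root_proportional[OF t(1) qP(2)] False by blast
    qed
    have "y \<noteq> 0"
    proof
      assume "y = 0"
      then have "pos_root t (Inr i) = x * pos_root p (Inr i)" for i using xy by simp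
      then show False using pos_root_proportional[OF t(1) pP(2)] False by blast
    qed
    have "pos_root t = lin_comb x (pos_root p) y (pos_root q)" using xy by (auto simp: lin_comb_def)
    then have "2 = x * pairing (pos_root t) (pos_root p) + y * pairing (pos_root t) (pos_root q)"
      using pairing_self[OF pos_root_roots[OF t(1)]] pairing_lin_comb by metis
    then have "pairing (pos_root t) (pos_root p) > 0 \<or> pairing (pos_root t) (pos_root q) > 0"
      using xy(1,2) by (smt (verit) mult_nonneg_nonpos)
    then show ?thesis
    proof
      assume "pairing (pos_root t) (pos_root p) > 0"
      then have "len (p \<otimes> t \<otimes> p) < len t"
        using extreme_descent[OF a b p q pq less.prems] False xy \<open>y \<noteq> 0\<close> by simp
      then obtain k where k: "odd k" "p \<otimes> t \<otimes> p = dih_elt p q k"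
        using less.hyps plane_conj pP(1) less.prems by blast
      have "t = p \<otimes> (p \<otimes> t \<otimes> p) \<otimes> p"
        using t pP by (simp add: m_assoc T_cancel)
      then have "t = dih_elt p q (2 - k)" using k dih_elt_conj(1)[OF k(1)] by simp
      then show ?thesis using k(1) by (intro exI[of _ "2 - k"]) auto
    next
      assume "pairing (pos_root t) (pos_root q) > 0"
      moreover have "pos_root t i = y * pos_root q i + x * pos_root p i" for i using xy(3)[of i] by simp
      ultimately have "len (q \<otimes> t \<otimes> q) < len t"
        using extreme_descent[OF a b q p pq[symmetric] less.prems, of y x] False xy(1) \<open>x \<noteq> 0\<close> by simp
      then obtain k where k: "odd k" "q \<otimes> t \<otimes> q = dih_elt p q k"
        using less.hyps plane_conj qP(1) less.prems by blast
      have "t = q \<otimes> (q \<otimes> t \<otimes> q) \<otimes> q"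
        using t qP by (simp add: m_assoc T_cancel)
      then have "t = dih_elt p q (-2 - k)" using k dih_elt_conj(2)[OF k(1)] by simp
      then show ?thesis using k(1) by (intro exI[of _ "-2 - k"]) auto
    qed
  qed
qed

lemma dih_elt_in_plane: "odd k \<Longrightarrow> dih_elt p q k \<in> plane a b"
proof -
  have conj: "dih_elt p q (2 - k) \<in> plane a b" "dih_elt p q (-2 - k) \<in> plane a b"
    if "odd k" "dih_elt p q k \<in> plane a b" for k
    using dih_elt_conj[OF that(1)] plane_conj[OF pP(1) that(2)] plane_conj[OF qP(1) that(2)] by simp_all
  have *: "dih_elt p q (1 + 2 * int n) \<in> plane a b \<and> dih_elt p q (-1 - 2 * int n) \<in> plane a b" for n
  proof (induction n)
    case 0
    then show ?case using pP qP dih_elt_1[OF invols] dih_elt_m1[OF invols] by simp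
  next
    case (Suc n)
    then show ?case using conj(1)[of "-1 - 2 * int n"] conj(2)[of "1 + 2 * int n"]
      by (simp add: algebra_simps)
  qed
  assume "odd k"
  then obtain j where "k = 2 * j + 1" by (elim oddE)
  then show ?thesis
    using *[of "nat j"] *[of "nat (- j - 1)"] by (cases "j \<ge> 0") (auto simp: algebra_simps)
qed

lemma dih_elt_conj_plane: "t \<in> plane a b \<Longrightarrow> dih_elt p q i \<otimes> t \<otimes> inv (dih_elt p q i) \<in> plane a b"
proof -
  assume "t \<in> plane a b"
  then obtain k where k: "odd k" "t = dih_elt p q k" using plane_subset_dih_elt by blast
  then have "\<exists>j. odd j \<and> dih_elt p q i \<otimes> t \<otimes> inv (dih_elt p q i) = dih_elt p q j"
    by (intro exI[of _ "if even i then 2 * i + k else 2 * i - k"]) (auto simp: dih_elt_rules)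
  then show ?thesis using dih_elt_in_plane by auto
qed

text \<open>The inverse of \<open>g x\<close> is \<open>x\<close> times the inverse of
  \<open>g\<close>. As \<open>x\<close> negates only its own root within the plane, a new inversion
  \<open>y\<close> can appear only if \<open>y g = g x\<close>, that is, if the elements of indices
  \<open>n + 1\<close> and \<open>- n - 1\<close> coincide.\<close>

lemma inverts_inv_dih_elt:
  assumes "\<And>j. 0 < j \<Longrightarrow> j < n + 1 \<Longrightarrow> dih_elt p q (int j) \<noteq> dih_elt p q (- int j)"
  shows "\<not> inverts (inv (dih_elt p q (int n))) q \<and> \<not> inverts (inv (dih_elt p q (- int n))) p"
  using assms
proof (induction n)
  case 0
  then show ?case using pP qP by (simp add: dih_elt_rules not_inverts_one)
next
  case (Suc n)
  have no_coll: "dih_elt p q (int n + 1) \<noteq> dih_elt p q (- int n - 1)"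
  proof -
    have "- int (n + 1) = - int n - 1" "int (n + 1) = int n + 1" by simp_all
    then show ?thesis using Suc.prems[of "n + 1"] by (metis add_less_cancel_right less_add_one zero_less_Suc Suc_eq_plus1)
  qed
  have IH: "\<not> inverts (inv (dih_elt p q (int n))) q" "\<not> inverts (inv (dih_elt p q (- int n))) p"
    using Suc by auto
  have main: "\<not> inverts (inv (dih_elt p q i \<otimes> x)) y"
    if xy: "x \<in> extreme a b" "y \<in> extreme a b" "\<not> inverts (inv (dih_elt p q i)) y"
      and neq: "y \<otimes> dih_elt p q i \<noteq> dih_elt p q i \<otimes> x" for i x y
  proof
    assume inverts: "inverts (inv (dih_elt p q i \<otimes> x)) y"
    note xP = extremeD[OF xy(1)] and yP = extremeD[OF xy(2)]
    define h where "h = inv (dih_elt p q i)"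
    have h: "h \<in> carrier G" "h = dih_elt p q (if even i then - i else i)" by (simp_all add: h_def dih_elt_rules)
    have "inv (dih_elt p q i \<otimes> x) = x \<otimes> h" using xP by (simp add: inv_mult_group T_inv dih_elt_rules(1) h_def)
    then have "inverts x (h \<otimes> y \<otimes> inv h)"
      using inverts inverts_mult[of x h y] xP yP h(1) xy(3) by (simp add: h_def)
    moreover have "h \<otimes> y \<otimes> inv h \<in> plane a b" unfolding h(2) using dih_elt_conj_plane yP by blast
    ultimately have "h \<otimes> y \<otimes> inv h = x" using xy(1) by (simp add: extreme_def)
    moreover have "inv h = dih_elt p q i" by (simp add: h_def dih_elt_rules(1))
    ultimately have "dih_elt p q i \<otimes> x = dih_elt p q i \<otimes> (h \<otimes> y \<otimes> dih_elt p q i)" by simp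
    also have "\<dots> = y \<otimes> dih_elt p q i" using yP by (simp add: h_def m_assoc dih_elt_rules(1))
    finally show False using neq by simp
  qed
  have eq: "-1 - int n = - int n - 1" "1 - - int n = int n + 1" by simp_all
  have "\<not> inverts (inv (dih_elt p q (int n) \<otimes> (if even (int n) then p else q))) q"
  proof (rule main)
    show "q \<otimes> dih_elt p q (int n) \<noteq> dih_elt p q (int n) \<otimes> (if even (int n) then p else q)"
      unfolding mult_dih_elt[OF invols] dih_elt_Suc[OF invols] eq using no_coll by simp
  qed (use p q IH in auto)
  moreover have "\<not> inverts (inv (dih_elt p q (- int n) \<otimes> (if even (- int n) then q else p))) p"
  proof (rule main)
    show "p \<otimes> dih_elt p q (- int n) \<noteq> dih_elt p q (- int n) \<otimes> (if even (- int n) then q else p)"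
      unfolding mult_dih_elt[OF invols] dih_elt_pred[OF invols] eq using no_coll by simp
  qed (use p q IH in auto)
  moreover have "int (Suc n) = int n + 1" "- int (Suc n) = - int n - 1" by auto
  ultimately show ?case unfolding dih_elt_Suc[OF invols] dih_elt_pred[OF invols] by (simp only:) simp
qed

end

subsection \<open>Dihedral cosets\<close>

text \<open>Indices \<open>j\<close> and \<open>- j\<close> are the two alternating products with
  \<open>j\<close> factors. They first coincide at the longest element, and the strict bound still
  admits \<open>n\<close> equal to its length.\<close>

definition injective_below :: "(int \<Rightarrow> 'a) \<Rightarrow> int \<Rightarrow> bool" where
  "injective_below f n \<longleftrightarrow> (\<forall>j. 0 < j \<and> j < n \<longrightarrow> f j \<noteq> f (- j))"

lemma injective_below_mono: "injective_below f n \<Longrightarrow> m \<le> n \<Longrightarrow> injective_below f m"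
  by (auto simp: injective_below_def)

context
  fixes a b p q
  assumes a: "a \<in> T" and b: "b \<in> T"
    and p: "p \<in> extreme a b" and q: "q \<in> extreme a b" and pq: "p \<noteq> q"
begin

lemmas invols' = invols[OF a b p q pq]
lemmas dih_elt_rules' = dih_elt_rules[OF a b p q pq]

text \<open>Each element of level \<open>n + 1\<close> arises from one element of level
  \<open>n\<close> by right and from the other by left multiplication with a generator;
  \<open>inverts_inv_dih_elt\<close> makes all four steps ascents.\<close>

lemma dih_elt_level_step:
  assumes inj: "injective_below (dih_elt p q) (int n + 1)" and "\<bar>i\<bar> = int n" "\<bar>j\<bar> = int n + 1"
  shows "len (dih_elt p q i) < len (dih_elt p q j)"
proof -
  have pT: "p \<in> T" "q \<in> T" using extremeD p q by auto
  have E: "\<not> inverts (inv (dih_elt p q (int n))) q" "\<not> inverts (inv (dih_elt p q (- int n))) p"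
    using inverts_inv_dih_elt[OF a b p q pq, of n] inj by (auto simp: injective_below_def)
  have left: "len (dih_elt p q k) < len (y \<otimes> dih_elt p q k)" if "\<not> inverts (inv (dih_elt p q k)) y" "y \<in> T" for k y
  proof -
    have "inv (dih_elt p q k) \<otimes> y = inv (y \<otimes> dih_elt p q k)"
      using that by (simp add: inv_mult_group T_inv T_carrier dih_elt_rules'(1))
    then show ?thesis using that not_inverts[of "inv (dih_elt p q k)" y]
      by (simp add: len_inv T_carrier dih_elt_rules'(1))
  qed
  have right: "len (dih_elt p q k) < len (dih_elt p q k \<otimes> y)" if "\<not> inverts (dih_elt p q k) y" "y \<in> T" for k y
    using that not_inverts dih_elt_rules'(1) by blast
  have "len (dih_elt p q (int n)) < len (dih_elt p q (-1 - int n))"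
    using left[OF E(1) pT(2)] by (simp only: mult_dih_elt[OF invols'])
  moreover have "len (dih_elt p q (- int n)) < len (dih_elt p q (int n + 1))"
    using left[OF E(2) pT(1)] by (simp add: mult_dih_elt[OF invols'] add.commute)
  moreover have "len (dih_elt p q (int n)) < len (dih_elt p q (int n + 1))"
    unfolding dih_elt_Suc[OF invols', symmetric]
    using E pT by (intro right) (auto simp: dih_elt_rules'(4))
  moreover have "len (dih_elt p q (- int n)) < len (dih_elt p q (- int n - 1))"
    unfolding dih_elt_pred[OF invols', symmetric]
    using E pT by (intro right) (auto simp: dih_elt_rules'(4))
  moreover have "i = int n \<or> i = - int n" "j = int n + 1 \<or> j = -1 - int n" "- int n - 1 = -1 - int n"
    using assms by auto
  ultimately show ?thesis by metis
qed

text \<open>The least collision \<open>m\<close> yields the period \<open>2 m\<close>, so every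
  index can be moved to absolute value at most \<open>m\<close>; minimality of \<open>m\<close>
  gives injectivity below.\<close>

lemma dih_elt_injective_rep:
  "\<exists>j. dih_elt p q j = dih_elt p q k \<and> even (j + k) \<and> injective_below (dih_elt p q) \<bar>j\<bar>"
proof (cases "\<exists>m>0. dih_elt p q (int m) = dih_elt p q (- int m)")
  case False
  have "injective_below (dih_elt p q) \<bar>k\<bar>"
    unfolding injective_below_def using False by (metis zero_less_imp_eq_int)
  then show ?thesis by (intro exI[of _ k]) simp
next
  case True
  define m where "m = (LEAST m. m > 0 \<and> dih_elt p q (int m) = dih_elt p q (- int m))"
  have m: "m > 0" "dih_elt p q (int m) = dih_elt p q (- int m)"
    using LeastI_ex[OF True] by (auto simp: m_def)
  have least: "n > 0 \<Longrightarrow> dih_elt p q (int n) = dih_elt p q (- int n) \<Longrightarrow> m \<le> n" for n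
    unfolding m_def by (intro Least_le) simp
  have "dih_elt p q (2 * int m) = \<one>"
  proof (cases "even m")
    case True
    then have "dih_elt p q (2 * int m) = dih_elt p q (int m) \<otimes> dih_elt p q (int m)" by (simp add: dih_elt_rules')
    also have "\<dots> = dih_elt p q (- int m) \<otimes> dih_elt p q (int m)" using m by simp
    also have "\<dots> = \<one>" using True by (simp add: dih_elt_rules')
    finally show ?thesis .
  next
    case False
    then have "dih_elt p q (2 * int m) = dih_elt p q (int m) \<otimes> dih_elt p q (- int m)" by (simp add: dih_elt_rules')
    also have "\<dots> = dih_elt p q (int m) \<otimes> dih_elt p q (int m)" using m by simp
    also have "\<dots> = \<one>" using False by (simp add: dih_elt_rules')
    finally show ?thesis .
  qed
  then have "(p \<otimes> q) [^] m = \<one>" by (simp add: dih_elt_def int_pow_int)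
  then have "(p \<otimes> q) [^] (m * l) = \<one>" for l
    using invols' nat_pow_pow[of "p \<otimes> q" m l] by simp
  then have period: "dih_elt p q (k + 2 * (int m * int l)) = dih_elt p q k" for k l
    using dih_elt_period[OF invols', of "m * l" k] by simp
  \<comment> \<open>The number of periods that brings \<open>k\<close> into the range from
    \<open>- m\<close> to \<open>m - 1\<close>.\<close>
  define l where "l = (k + int m) div (2 * int m)"
  define j where "j = k - 2 * (int m * l)"
  have "j = (k + int m) mod (2 * int m) - int m"
    using minus_div_mult_eq_mod[of "k + int m" "2 * int m"] by (simp add: j_def l_def algebra_simps)
  moreover have "0 \<le> (k + int m) mod (2 * int m)" "(k + int m) mod (2 * int m) < 2 * int m"
    using m(1) by simp_all
  ultimately have "\<bar>j\<bar> \<le> int m" by linarith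
  have "dih_elt p q j = dih_elt p q k"
  proof (cases "l \<ge> 0")
    case True
    then show ?thesis using period[of j "nat l"] by (simp add: j_def)
  next
    case False
    then show ?thesis using period[of k "nat (- l)"] by (simp add: j_def algebra_simps)
  qed
  moreover have "injective_below (dih_elt p q) \<bar>j\<bar>"
    unfolding injective_below_def
  proof (intro allI impI notI)
    fix i assume i: "0 < i \<and> i < \<bar>j\<bar>" "dih_elt p q i = dih_elt p q (- i)"
    then have "m \<le> nat i" using least[of "nat i"] by simp
    then show False using i \<open>\<bar>j\<bar> \<le> int m\<close> by linarith
  qed
  moreover have "even (j + k)" by (simp add: j_def)
  ultimately show ?thesis by blast
qed

text \<open>A shortest element of the coset has neither generator as a descent. It keeps the roots
  of \<open>p\<close> and \<open>q\<close> positive, hence the whole cone.\<close>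

lemma minimal_coset_rep:
  assumes "x \<in> carrier G"
  shows "\<exists>z k. z \<in> carrier G \<and> x = z \<otimes> dih_elt p q k \<and> (\<forall>t\<in>plane a b. \<not> inverts z t)"
proof -
  obtain k where min: "\<And>j. len (x \<otimes> dih_elt p q k) \<le> len (x \<otimes> dih_elt p q j)"
    using ex_has_least_nat[of "\<lambda>_. True" 0 "\<lambda>j. len (x \<otimes> dih_elt p q j)"] by blast
  define z where "z = x \<otimes> dih_elt p q k"
  have z: "z \<in> carrier G" using assms by (simp add: z_def dih_elt_rules'(1))
  note pT = extremeD[OF p] and qT = extremeD[OF q]
  have "\<not> inverts z y" if "y \<in> {p, q}" for y
  proof -
    have "\<exists>j. dih_elt p q k \<otimes> y = dih_elt p q j"
      using that dih_elt_Suc[OF invols', of k] dih_elt_pred[OF invols', of k] by (cases "even k") auto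
    moreover have "y \<in> carrier G" using that pT qT by auto
    ultimately obtain j where "z \<otimes> y = x \<otimes> dih_elt p q j"
      using assms by (auto simp: z_def m_assoc dih_elt_rules'(1))
    then show ?thesis using min[of j] by (simp add: inverts_def z_def)
  qed
  then have nonneg: "nonneg (act z (pos_root p))" "nonneg (act z (pos_root q))" using inverts_iff z pT qT by auto
  have "\<not> inverts z t" if t: "t \<in> plane a b" for t
  proof -
    obtain u v where "u \<ge> 0" "v \<ge> 0" "\<And>i. pos_root t i = u * pos_root p i + v * pos_root q i"
      using extreme_generate_cone[OF a b p q pq t] by blast
    moreover from this have "pos_root t = lin_comb u (pos_root p) v (pos_root q)" by (auto simp: lin_comb_def)
    ultimately have "nonneg (act z (pos_root t))" using nonneg z by (simp add: act_lin_comb nonneg_lin_comb)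
    then show ?thesis using inverts_iff z plane_T t by blast
  qed
  moreover have "x = z \<otimes> dih_elt p q (if even k then - k else k)"
    using assms by (simp add: z_def m_assoc dih_elt_rules'(1) flip: dih_elt_rules'(4))
  ultimately show ?thesis using z by blast
qed

end

text \<open>\<open>f\<close> enumerates a coset of the dihedral group with reflections \<open>P\<close>, and \<open>\<bar>k\<bar>\<close> is the dihedral length of \<open>f k\<close>
  above the minimal element \<open>f 0\<close>. When the group is finite \<open>f\<close> is periodic, and only the indices up to
  the length of the longest element satisfy \<open>injective_below f \<bar>k\<bar>\<close>.\<close>

definition coset_levels :: "'a set \<Rightarrow> (int \<Rightarrow> 'a) \<Rightarrow> bool" where
  "coset_levels P f \<longleftrightarrow>
    (\<forall>k. f k \<in> carrier G) \<and>
    (\<forall>k. \<forall>t\<in>P. \<exists>j. f k \<otimes> t = f j) \<and>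
    (\<forall>i j. odd (i + j) \<longrightarrow> (\<exists>t\<in>P. f j = f i \<otimes> t)) \<and>
    (\<forall>i j. even (len (f i) + len (f j)) \<longleftrightarrow> even (i + j)) \<and>
    (\<forall>k. \<exists>j. f j = f k \<and> injective_below f \<bar>j\<bar>) \<and>
    (\<forall>i j. injective_below f \<bar>j\<bar> \<longrightarrow> \<bar>i\<bar> < \<bar>j\<bar> \<longrightarrow> len (f i) < len (f j))"

theorem plane_coset_levels:
  assumes ab: "a \<in> T" "b \<in> T" "a \<noteq> b" and x: "x \<in> carrier G"
  obtains f k where "coset_levels (plane a b) f" "x = f k"
proof -
  obtain p q where p: "p \<in> extreme a b" and q: "q \<in> extreme a b" and pq: "p \<noteq> q"
    using two_extreme ab by blast
  note hyps = ab(1,2) p q pq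
  note D = dih_elt_rules[OF hyps]
  obtain z k where z: "z \<in> carrier G" "x = z \<otimes> dih_elt p q k" "\<And>t. t \<in> plane a b \<Longrightarrow> \<not> inverts z t"
    using minimal_coset_rep[OF hyps x] by blast
  define f where "f j = z \<otimes> dih_elt p q j" for j
  have closed: "f j \<in> carrier G" for j using z by (simp add: f_def D(1))
  have inj: "injective_below f n \<longleftrightarrow> injective_below (dih_elt p q) n" for n
    using z(1) D(1) by (simp add: injective_below_def f_def)
  have mult: "\<exists>t\<in>plane a b. dih_elt p q j = dih_elt p q i \<otimes> t" if "odd (i + j)" for i j
  proof -
    define m where "m = (if even i then j - i else i - j)"
    have "dih_elt p q i \<otimes> dih_elt p q m = dih_elt p q j" by (simp add: m_def D)
    moreover have "dih_elt p q m \<in> plane a b" using dih_elt_in_plane[OF hyps] that by (simp add: m_def)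
    ultimately show ?thesis by metis
  qed
  then have mult_f: "\<exists>t\<in>plane a b. f j = f i \<otimes> t" if "odd (i + j)" for i j
    using that z(1) D(1) plane_T T_carrier by (metis f_def m_assoc)
  \<comment> \<open>\<open>z\<close> inverts nothing in the plane, so by the cocycle rule
    \<open>z g\<close> inverts \<open>t\<close> exactly if \<open>g\<close> does.\<close>
  have lift: "len (f i) < len (f j)" if "odd (i + j)" and lt: "len (dih_elt p q i) < len (dih_elt p q j)" for i j
  proof -
    obtain t where t: "t \<in> plane a b" "dih_elt p q j = dih_elt p q i \<otimes> t"
      using mult \<open>odd (i + j)\<close> by blast
    note tT = plane_T[OF t(1)] T_carrier[OF plane_T[OF t(1)]]
    have "\<not> inverts (dih_elt p q i) t" using lt t by (simp add: inverts_def)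
    moreover have "\<not> inverts z (dih_elt p q i \<otimes> t \<otimes> inv (dih_elt p q i))"
      using z dih_elt_conj_plane[OF hyps] t by blast
    ultimately have "\<not> inverts (f i) t" using inverts_mult[of z "dih_elt p q i" t] z(1) D(1) tT by (simp add: f_def)
    then show ?thesis using not_inverts closed tT t z(1) D(1) by (simp add: f_def m_assoc)
  qed
  have mono: "len (f i) < len (f j)" if "injective_below f \<bar>j\<bar>" "\<bar>i\<bar> < \<bar>j\<bar>" for i j
  proof -
    have "\<forall>j. injective_below f \<bar>j\<bar> \<longrightarrow> \<bar>j\<bar> = int n \<longrightarrow> \<bar>i\<bar> < \<bar>j\<bar> \<longrightarrow> len (f i) < len (f j)" for n
    proof (induction n)
      case (Suc n)
      show ?case
      proof (intro allI impI)
        fix j assume j: "injective_below f \<bar>j\<bar>" "\<bar>j\<bar> = int (Suc n)" "\<bar>i\<bar> < \<bar>j\<bar>"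
        have step: "len (f k) < len (f j)" if "\<bar>k\<bar> = int n" for k
        proof (rule lift)
          have "\<bar>j\<bar> = int n + 1" using j by simp
          then show "len (dih_elt p q k) < len (dih_elt p q j)"
            using dih_elt_level_step[OF hyps _ that] j(1) inj by metis
          show "odd (k + j)" using that j(2) by presburger
        qed
        show "len (f i) < len (f j)"
        proof (cases "\<bar>i\<bar> = int n")
          case False
          then have "len (f i) < len (f (int n))"
            using Suc j injective_below_mono[OF j(1)] by simp
          then show ?thesis using step[of "int n"] by simp
        qed (rule step)
      qed
    qed simp
    from this[of "nat \<bar>j\<bar>"] show ?thesis using that by simp
  qed
  have parity0: "even (len (f j)) \<longleftrightarrow> (even (len (f 0)) \<longleftrightarrow> even j)" for j
  proof -
    have odd: "even (len (f j)) \<longleftrightarrow> odd (len (f i))" if "odd (i + j)" for i j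
    proof -
      obtain t where "t \<in> plane a b" "f j = f i \<otimes> t" using mult_f \<open>odd (i + j)\<close> by blast
      then show ?thesis using even_len_mult[of "f i" t] closed plane_T T_carrier odd_len_T by auto
    qed
    show ?thesis
    proof (cases "even j")
      case True
      then show ?thesis using odd[of 1 j] odd[of 1 0] by auto
    next
      case False
      then show ?thesis using odd[of 0 j] by auto
    qed
  qed
  have "\<exists>j. f k \<otimes> t = f j" if "t \<in> plane a b" for k t
  proof -
    obtain m where "odd m" "t = dih_elt p q m" using plane_subset_dih_elt[OF hyps \<open>t \<in> plane a b\<close>] by blast
    then have "\<exists>j. dih_elt p q k \<otimes> t = dih_elt p q j" by (cases "even k") (auto simp: D)
    then show ?thesis using z(1) D(1) T_carrier plane_T[OF that] by (metis f_def m_assoc)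
  qed
  moreover have "even (len (f i) + len (f j)) \<longleftrightarrow> even (i + j)" for i j
    using parity0[of i] parity0[of j] by auto
  moreover have "\<exists>j. f j = f k \<and> injective_below f \<bar>j\<bar>" for k
    using dih_elt_injective_rep[OF hyps, of k] unfolding inj f_def by metis
  ultimately have "coset_levels (plane a b) f"
    unfolding coset_levels_def using closed mult_f mono by blast
  moreover have "x = f k" using z by (simp add: f_def)
  ultimately show ?thesis using that by blast
qed

subsection \<open>Crowns and diamonds in the Bruhat graph\<close>

abbreviation adj :: "'a \<Rightarrow> 'a \<Rightarrow> bool" where "adj \<equiv> gamma_adj G S"

definition up :: "'a set \<Rightarrow> 'a \<Rightarrow> 'a \<Rightarrow> bool" where
  "up P x y \<longleftrightarrow> x \<in> carrier G \<and> (\<exists>t\<in>P. y = x \<otimes> t) \<and> len x < len y"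

lemma up_T: "up T = bruhat_step G S"
  by (auto simp: up_def bruhat_step_def fun_eq_iff)

lemma up_mono: "up P x y \<Longrightarrow> P \<subseteq> Q \<Longrightarrow> up Q x y"
  by (auto simp: up_def)

definition crown :: "'a set \<Rightarrow> 'a \<Rightarrow> 'a \<Rightarrow> bool" where
  "crown P x y \<longleftrightarrow> (\<exists>a b c d. a \<noteq> b \<and> c \<noteq> d \<and> up P x a \<and> up P x b \<and> up P a c \<and> up P a d \<and>
     up P b c \<and> up P b d \<and> up P c y \<and> up P d y)"

lemma coset_levelsD:
  assumes "coset_levels P f"
  shows "f k \<in> carrier G" "t \<in> P \<Longrightarrow> \<exists>j. f k \<otimes> t = f j"
    "odd (i + j) \<Longrightarrow> \<exists>t\<in>P. f j = f i \<otimes> t"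
    "even (len (f i) + len (f j)) \<longleftrightarrow> even (i + j)"
    "\<exists>j. f j = f k \<and> injective_below f \<bar>j\<bar>"
    "injective_below f \<bar>j\<bar> \<Longrightarrow> \<bar>i\<bar> < \<bar>j\<bar> \<Longrightarrow> len (f i) < len (f j)"
  using assms unfolding coset_levels_def by blast+

lemma coset_levels_up:
  assumes f: "coset_levels P f" and "P \<subseteq> T" and up: "up P (f i) y" and i: "injective_below f \<bar>i\<bar>"
  obtains j where "y = f j" "injective_below f \<bar>j\<bar>" "\<bar>i\<bar> < \<bar>j\<bar>" "odd (i + j)"
proof -
  obtain t where t: "t \<in> P" "y = f i \<otimes> t" "len (f i) < len y" using up by (auto simp: up_def)
  then obtain j where j: "y = f j" "injective_below f \<bar>j\<bar>"
    using coset_levelsD(2,5)[OF f] by metis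
  have "t \<in> T" using t \<open>P \<subseteq> T\<close> by blast
  then have "odd (len (f i) + len (f j))"
    using even_len_mult[of "f i" t] coset_levelsD(1)[OF f] T_carrier odd_len_T t j by auto
  then have odd: "odd (i + j)" using coset_levelsD(4)[OF f] by blast
  then have "\<bar>i\<bar> \<noteq> \<bar>j\<bar>" by presburger
  moreover have "\<not> \<bar>j\<bar> < \<bar>i\<bar>" using coset_levelsD(6)[OF f i, of j] t j by auto
  ultimately show ?thesis using that[OF j _ odd] by linarith
qed

lemma coset_levels_upI:
  assumes f: "coset_levels P f" "injective_below f \<bar>j\<bar>" "\<bar>i\<bar> < \<bar>j\<bar>" "odd (i + j)"
  shows "up P (f i) (f j)"
  using coset_levelsD(1,3,6)[OF f(1)] f unfolding up_def by blast

text \<open>The three edges raise the level by at least 3, so two full levels, \<open>n\<close> and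
  \<open>n + 1\<close>, lie strictly between. Each holds two distinct elements, and indices of
  opposite parity are joined by a reflection of the plane.\<close>

lemma path_imp_crown:
  assumes ab: "a \<in> T" "b \<in> T" "a \<noteq> b"
    and up: "up (plane a b) x u" "up (plane a b) u v" "up (plane a b) v y"
  shows "crown (plane a b) x y"
proof -
  have sub: "plane a b \<subseteq> T" using plane_T by blast
  have "x \<in> carrier G" using up by (simp add: up_def)
  then obtain f k where f: "coset_levels (plane a b) f" "x = f k"
    using plane_coset_levels ab by blast
  obtain i where i: "x = f i" "injective_below f \<bar>i\<bar>" using coset_levelsD(5)[OF f(1)] f(2) by metis
  obtain i1 where i1: "u = f i1" "injective_below f \<bar>i1\<bar>" "\<bar>i\<bar> < \<bar>i1\<bar>" "odd (i + i1)"
    using coset_levels_up[OF f(1) sub _ i(2)] up(1) i(1) by metis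
  obtain i2 where i2: "v = f i2" "injective_below f \<bar>i2\<bar>" "\<bar>i1\<bar> < \<bar>i2\<bar>" "odd (i1 + i2)"
    using coset_levels_up[OF f(1) sub _ i1(2)] up(2) i1(1) by metis
  obtain i3 where i3: "y = f i3" "injective_below f \<bar>i3\<bar>" "\<bar>i2\<bar> < \<bar>i3\<bar>" "odd (i2 + i3)"
    using coset_levels_up[OF f(1) sub _ i2(2)] up(3) i2(1) by metis
  define n where "n = \<bar>i\<bar> + 1"
  have inj: "injective_below f m" if "m \<le> \<bar>i3\<bar>" for m
    using injective_below_mono i3(2) that by blast
  have bounds: "0 < n" "n + 1 < \<bar>i3\<bar>" "\<bar>n\<bar> = n" "\<bar>n + 1\<bar> = n + 1" "\<bar>- n\<bar> = n" "\<bar>- (n + 1)\<bar> = n + 1"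
    using i1 i2 i3 by (auto simp: n_def)
  have par: "odd (i + n)" "odd (i + - n)" "odd (n + (n + 1))" "odd (n + - (n + 1))"
    "odd (- n + (n + 1))" "odd (- n + - (n + 1))" by (auto simp: n_def)
  have "odd (n + 1 + i3)" "odd (- (n + 1) + i3)" using i1(4) i2(4) i3(4) unfolding n_def by presburger+
  moreover have "f n \<noteq> f (- n)" "f (n + 1) \<noteq> f (- (n + 1))"
    using i3(2)[unfolded injective_below_def, rule_format, of n]
      i3(2)[unfolded injective_below_def, rule_format, of "n + 1"] bounds(1,2) by auto
  moreover have U: "up (plane a b) (f g) (f h)" if "\<bar>g\<bar> < \<bar>h\<bar>" "\<bar>h\<bar> \<le> \<bar>i3\<bar>" "odd (g + h)" for g h
    using coset_levels_upI[OF f(1) inj] that by blast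
  have i_less: "\<bar>i\<bar> < n" by (simp add: n_def)
  note odds = par calculation(1,2)
  moreover have "up (plane a b) (f i) (f n)"
    by (rule U[OF _ _ odds(1)]; use bounds i_less in linarith)
  moreover have "up (plane a b) (f i) (f (- n))"
    by (rule U[OF _ _ odds(2)]; use bounds i_less in linarith)
  moreover have "up (plane a b) (f n) (f (n + 1))"
    by (rule U[OF _ _ odds(3)]; use bounds i_less in linarith)
  moreover have "up (plane a b) (f n) (f (- (n + 1)))"
    by (rule U[OF _ _ odds(4)]; use bounds i_less in linarith)
  moreover have "up (plane a b) (f (- n)) (f (n + 1))"
    by (rule U[OF _ _ odds(5)]; use bounds i_less in linarith)
  moreover have "up (plane a b) (f (- n)) (f (- (n + 1)))"
    by (rule U[OF _ _ odds(6)]; use bounds i_less in linarith)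
  moreover have "up (plane a b) (f (n + 1)) (f i3)"
    by (rule U[OF _ _ odds(7)]; use bounds i_less in linarith)
  moreover have "up (plane a b) (f (- (n + 1))) (f i3)"
    by (rule U[OF _ _ odds(8)]; use bounds i_less in linarith)
  ultimately show ?thesis unfolding crown_def i(1) i3(1) by blast
qed

text \<open>\<open>x\<close> keeps the root of \<open>t\<close> positive, and so does
  \<open>s\<close> afterwards unless \<open>x t\<close> equals \<open>s x\<close>; this is the
  excluded edge, which \<open>s\<close> reverses.\<close>

lemma up_left_mult:
  assumes "s \<in> S" "up P x y" "P \<subseteq> T" "y \<noteq> s \<otimes> x"
  shows "up P (s \<otimes> x) (s \<otimes> y)"
proof -
  obtain t where t: "t \<in> P" "y = x \<otimes> t" "x \<in> carrier G" "len x < len y"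
    using assms by (auto simp: up_def)
  have tT: "t \<in> T" "t \<in> carrier G" using t assms T_carrier by auto
  have s: "s \<in> carrier G" using assms S_carrier by simp
  have "x \<otimes> t \<otimes> inv x \<noteq> s"
  proof
    assume "x \<otimes> t \<otimes> inv x = s"
    then have "s \<otimes> x = x \<otimes> t" using t tT by (auto simp: m_assoc)
    then show False using assms t by simp
  qed
  then have "\<not> inverts (s \<otimes> x) t"
    using inverts_mult[of s x t] inverts_simple[OF assms(1)] T_conj t tT s by (auto simp: inverts_def)
  then have "len (s \<otimes> x) < len (s \<otimes> x \<otimes> t)" using not_inverts t tT s by simp
  moreover have "s \<otimes> y = s \<otimes> x \<otimes> t" using t tT s by (simp add: m_assoc)
  ultimately show ?thesis using t s unfolding up_def by auto
qed

text \<open>Take a left descent \<open>s\<close> of \<open>y\<close>. If \<open>s\<close> is an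
  ascent of \<open>x\<close>, then \<open>x, s x, s y, y\<close> is a path with labels in the plane
  of \<open>r\<close> and \<open>t\<close>. Otherwise a crown from \<open>s x\<close> to
  \<open>s y\<close> exists by induction, and \<open>s\<close> carries a path in it to one from
  \<open>x\<close> to \<open>y\<close>. By \<open>path_imp_crown\<close> a path is enough.\<close>

theorem long_edge_crown:
  assumes "x \<in> carrier G" "t \<in> T" "len x + 3 \<le> len (x \<otimes> t)"
  shows "\<exists>a b. a \<in> T \<and> b \<in> T \<and> a \<noteq> b \<and> crown (plane a b) x (x \<otimes> t)"
  using assms
proof (induction "len (x \<otimes> t)" arbitrary: x rule: less_induct)
  case less
  note x = less.prems(1) and t = less.prems(2) T_carrier[OF less.prems(2)]
  define y where "y = x \<otimes> t"
  have y: "y \<in> carrier G" using x t by (simp add: y_def)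
  have xy: "len x + 3 \<le> len y" using less.prems by (simp add: y_def)
  then have "y \<noteq> \<one>" by auto
  then obtain s where s: "s \<in> S" "len y = Suc (len (s \<otimes> y))" using left_descent y by blast
  note sC = S_carrier[OF s(1)] T_cancel[OF S_T[OF s(1)]]
  have sy: "s \<otimes> y = s \<otimes> x \<otimes> t" using x t sC by (simp add: y_def m_assoc)
  show ?case
  proof (cases "len x < len (s \<otimes> x)")
    case True
    then have lsx: "len (s \<otimes> x) = Suc (len x)" using S_len_mult[OF x s(1)] by auto
    define r where "r = inv x \<otimes> s \<otimes> x"
    have r: "r \<in> T" "r \<in> carrier G"
      using T_conj[OF S_T[OF s(1)], of "inv x"] x sC by (auto simp: r_def)
    have xr: "x \<otimes> r = s \<otimes> x" using x sC by (simp add: r_def m_assoc)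
    have "r \<noteq> t" using xr lsx xy by (auto simp: y_def)
    note P = plane_generators[OF r(1) t(1)]
    have "up (plane r t) x (s \<otimes> x)" using x P xr lsx unfolding up_def by force
    moreover have "up (plane r t) (s \<otimes> x) (s \<otimes> y)"
      unfolding up_def using x sC P sy lsx s(2) xy by auto
    moreover have "s \<otimes> y \<otimes> (t \<otimes> r \<otimes> t) = y"
    proof -
      have "s \<otimes> y \<otimes> (t \<otimes> r \<otimes> t) = s \<otimes> (x \<otimes> (t \<otimes> (t \<otimes> (r \<otimes> t))))"
        using sy x sC t r by (simp add: m_assoc)
      also have "\<dots> = s \<otimes> (x \<otimes> r \<otimes> t)" using x t r by (simp add: T_cancel m_assoc)
      also have "\<dots> = s \<otimes> (s \<otimes> (x \<otimes> t))" using xr x t sC by (simp add: m_assoc)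
      also have "\<dots> = y" using x t sC by (simp add: y_def)
      finally show ?thesis .
    qed
    then have "up (plane r t) (s \<otimes> y) y"
      unfolding up_def using y sC s(2) plane_conj[OF P(2,1)] by force
    ultimately show ?thesis
      using path_imp_crown[OF r(1) t(1) \<open>r \<noteq> t\<close>] r t \<open>r \<noteq> t\<close> unfolding y_def by blast
  next
    case False
    then have lsx: "len x = Suc (len (s \<otimes> x))" using S_len_mult[OF x s(1)] by auto
    have "\<exists>a b. a \<in> T \<and> b \<in> T \<and> a \<noteq> b \<and> crown (plane a b) (s \<otimes> x) (s \<otimes> x \<otimes> t)"
      using s(2) lsx xy x sC t sy unfolding y_def by (intro less.hyps) (auto simp: y_def)
    then obtain a b where ab: "a \<in> T" "b \<in> T" "a \<noteq> b" and "crown (plane a b) (s \<otimes> x) (s \<otimes> y)"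
      unfolding sy by blast
    then obtain u u' v v' where u: "u \<noteq> u'" "up (plane a b) (s \<otimes> x) u" "up (plane a b) (s \<otimes> x) u'"
      and v: "v \<noteq> v'" "up (plane a b) u v" "up (plane a b) u v'" "up (plane a b) u' v" "up (plane a b) u' v'"
        "up (plane a b) v (s \<otimes> y)" "up (plane a b) v' (s \<otimes> y)"
      unfolding crown_def by blast
    \<comment> \<open>The two atoms and two coatoms of the crown leave a choice that avoids the
      edges reversed by \<open>s\<close>: first \<open>w\<close> other than \<open>x\<close>, then
      \<open>c\<close> other than \<open>s \<otimes> w\<close>.\<close>
    obtain w where w: "w \<noteq> x" "up (plane a b) (s \<otimes> x) w" "up (plane a b) w v" "up (plane a b) w v'"
      using u v by metis
    obtain c where c: "c \<noteq> s \<otimes> w" "up (plane a b) w c" "up (plane a b) c (s \<otimes> y)"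
      using v w by metis
    have sub: "plane a b \<subseteq> T" using plane_T by blast
    have cancel: "s \<otimes> (s \<otimes> x) = x" "s \<otimes> (s \<otimes> y) = y" using sC x y by auto
    have "up (plane a b) x (s \<otimes> w)"
      using up_left_mult[OF s(1) w(2) sub] w(1) cancel by simp
    moreover have "up (plane a b) (s \<otimes> w) (s \<otimes> c)"
      using up_left_mult[OF s(1) c(2) sub c(1)] .
    moreover have "s \<otimes> y \<noteq> s \<otimes> c"
    proof
      assume eq: "s \<otimes> y = s \<otimes> c"
      have "c \<in> carrier G" using c(3) by (simp add: up_def)
      then have "y = c" using eq sC y by (metis Units_eq Units_l_cancel)
      then show False using c(3) s(2) by (simp add: up_def)
    qed
    then have "up (plane a b) (s \<otimes> c) y"
      using up_left_mult[OF s(1) c(3) sub] cancel by simp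
    ultimately show ?thesis using path_imp_crown[OF ab] ab unfolding y_def by blast
  qed
qed

text \<open>Equal products of two distinct reflections span the same plane, so all the labels of the crown lie
  in one dihedral group, where odd elements are reflections. Orientations play no role, which is
  why the lemma applies to images under a matching.\<close>

lemma undirected_crown:
  assumes x: "x \<in> carrier G" and "a \<noteq> b" "c \<noteq> d"
    and "adj x a" "adj x b" "adj a c" "adj a d" "adj b c" "adj b d" "adj c y" "adj d y"
  shows "adj x y"
proof -
  obtain a' b' where ab: "a' \<in> T" "b' \<in> T" "a = x \<otimes> a'" "b = x \<otimes> b'"
    using assms by (auto simp: gamma_adj_def)
  obtain r1 r2 r3 r4 where r: "r1 \<in> T" "r2 \<in> T" "r3 \<in> T" "r4 \<in> T"
    "c = a \<otimes> r1" "d = a \<otimes> r2" "c = b \<otimes> r3" "d = b \<otimes> r4"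
    using assms by (auto simp: gamma_adj_def)
  obtain r5 r6 where r': "r5 \<in> T" "r6 \<in> T" "y = c \<otimes> r5" "y = d \<otimes> r6"
    using assms by (auto simp: gamma_adj_def)
  note C = ab(1,2)[THEN T_carrier] r(1-4)[THEN T_carrier] r'(1,2)[THEN T_carrier]
  have neq: "a' \<noteq> b'" "r2 \<noteq> r1" using assms ab r by auto
  note P = plane_generators[OF ab(1,2)]
  \<comment> \<open>Two factorisations with the known labels \<open>p\<close>, \<open>q\<close> on
    the left become one product \<open>q \<otimes> p\<close> of known reflections, to which
    \<open>plane_product\<close> applies.\<close>
  have swap: "q \<otimes> p = u \<otimes> t" if "p \<otimes> t = q \<otimes> u" "p \<in> T" "q \<in> T" "t \<in> T" "u \<in> T" for p q t u
  proof -
    note C = that(2-5)[THEN T_carrier]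
    have "q \<otimes> p = q \<otimes> ((p \<otimes> t) \<otimes> t)" using that(4) C by (simp add: m_assoc T_square)
    also have "\<dots> = u \<otimes> t" unfolding that(1) using that C by (simp add: T_cancel m_assoc)
    finally show ?thesis .
  qed
  have "x \<otimes> a' \<otimes> r1 = x \<otimes> b' \<otimes> r3" "x \<otimes> a' \<otimes> r2 = x \<otimes> b' \<otimes> r4"
    using r(5-8) ab(3,4) by simp_all
  then have "a' \<otimes> r1 = b' \<otimes> r3" "a' \<otimes> r2 = b' \<otimes> r4"
    using x C by (simp_all add: m_assoc)
  then have "b' \<otimes> a' = r3 \<otimes> r1" "b' \<otimes> a' = r4 \<otimes> r2" using swap ab r by blast+
  then have in_P: "r1 \<in> plane a' b'" "r2 \<in> plane a' b'"
    using plane_product(2)[OF P(2,1) neq(1)[symmetric]] r by blast+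
  have "x \<otimes> a' \<otimes> r1 \<otimes> r5 = x \<otimes> a' \<otimes> r2 \<otimes> r6"
    using r(5,6) r'(3,4) ab(3) by simp
  then have "r1 \<otimes> r5 = r2 \<otimes> r6"
    using x C by (simp add: m_assoc)
  then have "r2 \<otimes> r1 = r6 \<otimes> r5" using swap r r' by blast
  then have r5: "r5 \<in> plane a' b'"
    using plane_product(2)[OF in_P(2,1) neq(2)] r' by blast
  obtain f k where f: "coset_levels (plane a' b') f" "x = f k"
    using plane_coset_levels ab(1,2) neq(1) x by blast
  obtain j where j: "y = f j"
    using coset_levelsD(2)[OF f(1)] P(1) in_P(1) r5 ab r r' f(2) by metis
  have "y = x \<otimes> (a' \<otimes> r1 \<otimes> r5)" using ab r r' x C by (simp add: m_assoc)
  \<comment> \<open>Three reflections lead from \<open>x\<close> to \<open>y\<close>, so their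
    indices in the coset differ in parity, and such elements differ by a single reflection.\<close>
  then have "odd (len x + len y)"
    using even_len_mult x C ab(1) r(1) r'(1) odd_len_T by simp
  then have "odd (k + j)" using coset_levelsD(4)[OF f(1)] f(2) j by blast
  then obtain t where "t \<in> plane a' b'" "y = x \<otimes> t" using coset_levelsD(3)[OF f(1)] f(2) j by blast
  then show ?thesis using plane_T by (auto simp: gamma_adj_def)
qed

text \<open>The labels of all paths of length two have the same product, so by
  \<open>plane_product\<close> they lie in one plane. The length difference 2 leaves room for a
  single intermediate level, with indices \<open>n\<close> and \<open>- n\<close>.\<close>

lemma diamond:
  assumes up: "up T x m" "up T m y" and len: "len y = len x + 2"
  obtains m' where "m' \<noteq> m" "up T x m'" "up T m' y" "\<And>w. up T x w \<Longrightarrow> up T w y \<Longrightarrow> w = m \<or> w = m'"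
proof -
  obtain t u where tu: "t \<in> T" "u \<in> T" "m = x \<otimes> t" "y = m \<otimes> u" and x: "x \<in> carrier G"
    using up by (auto simp: up_def)
  note C = tu(1,2)[THEN T_carrier]
  have "t \<noteq> u"
  proof
    assume "t = u"
    then have "y = x" using tu x C by (simp add: m_assoc T_square)
    then show False using len by simp
  qed
  define P where "P = plane t u"
  have sub: "P \<subseteq> T" using plane_T by (auto simp: P_def)
  have in_P: "up P x w \<and> up P w y" if w: "up T x w" "up T w y" for w
  proof -
    obtain t' u' where tu': "t' \<in> T" "u' \<in> T" "w = x \<otimes> t'" "y = w \<otimes> u'"
      using w by (auto simp: up_def)
    have "x \<otimes> t \<otimes> u = x \<otimes> t' \<otimes> u'" using tu(3,4) tu'(3,4) by simp
    then have "t \<otimes> u = t' \<otimes> u'"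
      using x C tu'(1,2)[THEN T_carrier] by (simp add: m_assoc)
    then have "t' \<in> P" "u' \<in> P"
      using plane_product[OF plane_generators[OF tu(1,2)] \<open>t \<noteq> u\<close>] tu' by (auto simp: P_def)
    then show ?thesis using w tu' by (auto simp: up_def)
  qed
  obtain f k where f: "coset_levels P f" "x = f k"
    using plane_coset_levels tu(1,2) \<open>t \<noteq> u\<close> x unfolding P_def by blast
  obtain i where i: "x = f i" "injective_below f \<bar>i\<bar>" using coset_levelsD(5)[OF f(1)] f(2) by metis
  define n where "n = \<bar>i\<bar> + 1"
  have level: "\<exists>j l. w = f j \<and> y = f l \<and> \<bar>j\<bar> = n \<and> \<bar>l\<bar> = n + 1 \<and> odd (j + l) \<and> injective_below f \<bar>l\<bar>"
    if w: "up T x w" "up T w y" for w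
  proof -
    have upP: "up P x w" "up P w y" using in_P w by auto
    obtain j where j: "w = f j" "injective_below f \<bar>j\<bar>" "\<bar>i\<bar> < \<bar>j\<bar>" "odd (i + j)"
      using coset_levels_up[OF f(1) sub _ i(2)] upP(1) i(1) by metis
    obtain l where l: "y = f l" "injective_below f \<bar>l\<bar>" "\<bar>j\<bar> < \<bar>l\<bar>" "odd (j + l)"
      using coset_levels_up[OF f(1) sub _ j(2)] upP(2) j(1) by metis
    have "\<not> n + 1 < \<bar>l\<bar>"
    proof
      assume nl: "n + 1 < \<bar>l\<bar>"
      have mono: "len (f g) < len (f h)" if "\<bar>g\<bar> < \<bar>h\<bar>" "\<bar>h\<bar> \<le> \<bar>l\<bar>" for g h
        using coset_levelsD(6)[OF f(1) injective_below_mono[OF l(2)]] that by blast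
      have "len (f i) < len (f n)" "len (f n) < len (f (n + 1))" "len (f (n + 1)) < len (f l)"
        using nl by (intro mono; simp add: n_def)+
      then show False using len i l by simp
    qed
    then show ?thesis using j l by (intro exI[of _ j] exI[of _ l]) (auto simp: n_def)
  qed
  obtain j l where jl: "m = f j" "y = f l" "\<bar>j\<bar> = n" "\<bar>l\<bar> = n + 1" "odd (j + l)" "injective_below f \<bar>l\<bar>"
    using level[OF up] by blast
  have "up P x (f (- j))" unfolding i(1)
  proof (rule coset_levels_upI[OF f(1)])
    show "injective_below f \<bar>- j\<bar>" using injective_below_mono[OF jl(6)] jl by simp
    show "odd (i + - j)" using jl(3) unfolding n_def by presburger
  qed (use jl in \<open>simp add: n_def\<close>)
  moreover have "up P (f (- j)) y" unfolding jl(2)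
    using jl by (intro coset_levels_upI[OF f(1)]) auto
  moreover have "f (- j) \<noteq> m"
  proof -
    have "f n \<noteq> f (- n)" using jl(4) jl(6)[unfolded injective_below_def, rule_format, of n] by (simp add: n_def)
    then show ?thesis using jl(1,3) by (cases "j \<ge> 0") auto
  qed
  moreover have "w = m \<or> w = f (- j)" if w: "up T x w" "up T w y" for w
  proof -
    obtain j' where "w = f j'" "\<bar>j'\<bar> = n" using level[OF w] by blast
    then show ?thesis using jl(1,3) by (auto simp: abs_eq_iff)
  qed
  ultimately show ?thesis using that[of "f (- j)"] up_mono[OF _ sub] by blast
qed

subsection \<open>Bruhat covers and special matchings\<close>

abbreviation le :: "'a \<Rightarrow> 'a \<Rightarrow> bool" where "le \<equiv> bruhat_le G S"

lemma up_carrier: "up P x y \<Longrightarrow> P \<subseteq> T \<Longrightarrow> y \<in> carrier G"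
  using T_carrier by (auto simp: up_def)

lemma up_adj: "up T x y \<Longrightarrow> adj x y"
  by (auto simp: up_def gamma_adj_def)

lemma adj_sym: "adj x y \<Longrightarrow> x \<in> carrier G \<Longrightarrow> adj y x"
  using T_carrier T_square by (force simp: gamma_adj_def m_assoc)

lemma adj_up: "\<lbrakk>adj x y; x \<in> carrier G; len x < len y\<rbrakk> \<Longrightarrow> up T x y"
  by (auto simp: up_def gamma_adj_def)

lemma adj_len_neq: "\<lbrakk>adj x y; x \<in> carrier G\<rbrakk> \<Longrightarrow> len x \<noteq> len y"
  using len_mult_T_neq by (metis gamma_adj_def)

lemma up_le: "up T x y \<Longrightarrow> le x y"
  unfolding bruhat_le_def up_T[symmetric] by (meson r_into_rtranclp up_def)

lemma le_trans: "le x y \<Longrightarrow> le y z \<Longrightarrow> le x z"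
  unfolding bruhat_le_def by auto

lemma le_cases:
  assumes "le x y" obtains "x = y" | x' where "up T x x'" "le x' y"
proof -
  have x: "x \<in> carrier G" and "(up T)\<^sup>*\<^sup>* x y"
    using assms by (auto simp: bruhat_le_def up_T)
  from this(2) show ?thesis
  proof (cases rule: converse_rtranclpE)
    case (step x')
    then have "x' \<in> carrier G" using up_carrier by blast
    then have "le x' y" using step by (simp add: bruhat_le_def up_T)
    then show ?thesis using that step by blast
  qed (use that in blast)
qed

lemma le_carrier: "le x y \<Longrightarrow> x \<in> carrier G \<and> y \<in> carrier G"
proof -
  assume "le x y"
  then have "x \<in> carrier G" "(up T)\<^sup>*\<^sup>* x y" by (auto simp: bruhat_le_def up_T)
  from this(2,1) show ?thesis by (induction rule: rtranclp_induct) (auto dest: up_carrier)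
qed

lemma le_len: "le x y \<Longrightarrow> x = y \<or> len x < len y"
proof -
  assume "le x y"
  then have "(up T)\<^sup>*\<^sup>* x y" by (auto simp: bruhat_le_def up_T)
  then show ?thesis by (induction rule: rtranclp_induct) (auto simp: up_def)
qed

lemma less_Suc_up:
  assumes "bruhat_less G S x y" "len y = len x + 1" shows "up T x y"
proof -
  have "le x y" "x \<noteq> y" using assms by (auto simp: bruhat_less_def)
  then obtain x' where x': "up T x x'" "le x' y" by (auto elim: le_cases)
  then show ?thesis using le_len[OF x'(2)] assms(2) by (auto simp: up_def)
qed

lemma less_len: "bruhat_less G S x y \<Longrightarrow> len x < len y"
  using le_len by (auto simp: bruhat_less_def)

text \<open>A cover is a single edge, and an edge of length difference at least 3 is refined by its
  crown; parity leaves only 1.\<close>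

lemma cover_iff: "bruhat_cover G S x y \<longleftrightarrow> up T x y \<and> len y = len x + 1"
proof
  assume up: "up T x y \<and> len y = len x + 1"
  then have "bruhat_less G S x y" using up_le by (auto simp: bruhat_less_def)
  moreover have False if "bruhat_less G S x z" "bruhat_less G S z y" for z
    using less_len[OF that(1)] less_len[OF that(2)] up by simp
  ultimately show "bruhat_cover G S x y" unfolding bruhat_cover_def by blast
next
  assume cover: "bruhat_cover G S x y"
  then have "le x y" "x \<noteq> y" by (auto simp: bruhat_cover_def bruhat_less_def)
  then obtain x' where x': "up T x x'" "le x' y" by (auto elim: le_cases)
  moreover have "le x x'" "x \<noteq> x'" using x'(1) up_le by (auto simp: up_def)
  ultimately have "x' = y"
    using cover by (auto simp: bruhat_cover_def bruhat_less_def)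
  then have up: "up T x y" using x' by simp
  then obtain t where t: "x \<in> carrier G" "t \<in> T" "y = x \<otimes> t" "len x < len y" by (auto simp: up_def)
  have "\<not> len x + 3 \<le> len y"
  proof
    assume "len x + 3 \<le> len y"
    then obtain a b where "crown (plane a b) x y" using long_edge_crown t by blast
    then obtain u v where "up (plane a b) x u" "up (plane a b) u v" "up (plane a b) v y"
      unfolding crown_def by blast
    then have uv: "up T x u" "up T u v" "up T v y"
      using up_mono plane_T by (meson subsetI)+
    then have "bruhat_less G S x u" "bruhat_less G S u y"
      using up_le le_trans unfolding bruhat_less_def by (metis less_irrefl less_trans up_def)+
    then show False using cover by (auto simp: bruhat_cover_def)
  qed
  moreover have "odd (len x + len y)"
    using even_len_mult[of x t] t T_carrier odd_len_T by auto
  ultimately have "len y = len x + 1" using t(4) by presburger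
  then show "up T x y \<and> len y = len x + 1" using up by simp
qed

theorem special_matching_automorphism:
  assumes M: "special_matching G S u v M"
  shows "gamma_automorphism G S u v M"
proof -
  define I where "I = bruhat_interval G S u v"
  have in_I: "x \<in> I \<longleftrightarrow> le u x \<and> le x v" for x by (simp add: I_def bruhat_interval_def)
  have carr: "x \<in> carrier G" if "x \<in> I" for x using that in_I le_carrier by blast
  have convex: "y \<in> I" if "x \<in> I" "z \<in> I" "up T x y" "up T y z" for x y z
    using that in_I up_le le_trans by meson
  have MI: "M x \<in> I" "M (M x) = x" if "x \<in> I" for x
    using M that unfolding special_matching_def I_def by auto
  have M_inj: "M x = M y \<Longrightarrow> x = y" if "x \<in> I" "y \<in> I" for x y using MI that by metis
  have M_cover: "(up T x (M x) \<and> len (M x) = len x + 1) \<or> (up T (M x) x \<and> len x = len (M x) + 1)"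
    if "x \<in> I" for x
    using M that unfolding special_matching_def I_def cover_iff by auto
  have special: "M x = y \<or> bruhat_less G S (M x) (M y)"
    if "x \<in> I" "y \<in> I" "up T x y" "len y = len x + 1" for x y
    using M that unfolding special_matching_def I_def cover_iff by auto

  have short: "adj (M x) (M y)" if x: "x \<in> I" and y: "y \<in> I" and xy: "up T x y" "len y = len x + 1" for x y
  proof (cases "M x = y")
    case True
    then have "M y = x" using MI x by metis
    then show ?thesis using True up_adj[OF xy(1)] adj_sym carr x by simp
  next
    case False
    then have less: "bruhat_less G S (M x) (M y)" using special that by blast
    show ?thesis
    proof (cases "len (M y) = len (M x) + 1")
      case True
      then show ?thesis using less_Suc_up[OF less] up_adj by blast
    next
      case neq: False
      \<comment> \<open>Diamonds show that \<open>[M x, M y]\<close> is a crown with two atoms \<open>x, a\<close> and two coatoms \<open>y, M a\<close>.\<close>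
      then have "len (M x) + 1 = len x" "len (M y) = len y + 1"
        using M_cover[OF x] M_cover[OF y] less_len[OF less] xy by auto
      then have down: "up T (M x) x" "len x = len (M x) + 1" and upy: "up T y (M y)" "len (M y) = len y + 1"
        using M_cover[OF x] M_cover[OF y] by auto
      \<comment> \<open>Were \<open>w\<close> matched downwards, the special condition for
        \<open>M x\<close> below \<open>w\<close> would give \<open>x < M w\<close>, although
        \<open>M w\<close> is shorter than \<open>x\<close>.\<close>
      have atom: "len (M w) = len w + 1" if w: "w \<in> I" "up T (M x) w" "len w = len x" "w \<noteq> x" for w
      proof (rule ccontr)
        assume "len (M w) \<noteq> len w + 1"
        then have "len w = len (M w) + 1" using M_cover[OF w(1)] by blast
        moreover have "bruhat_less G S x (M w)"
          using special[of "M x" w] MI x w down by auto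
        ultimately show False using less_len w by fastforce
      qed
      obtain a where a: "a \<noteq> x" "up T (M x) a" "up T a y"
        using diamond[OF down(1) xy(1)] down xy by auto
      have aI: "a \<in> I" using convex[OF _ y a(2,3)] MI x by blast
      have la: "len a = len x" using a(2,3) down(2) xy(2) by (simp add: up_def)
      have lMa: "len (M a) = len y" using atom[OF aI a(2) la a(1)] la xy by simp
      obtain c where c: "c \<noteq> y" "up T a c" "up T c (M y)"
        using diamond[OF a(3) upy(1)] la upy xy by auto
      have cI: "c \<in> I" using convex[OF aI _ c(2,3)] MI y by blast
      have lc: "len c = len y" using c(2,3) la upy(2) xy(2) by (simp add: up_def)
      have "M c \<noteq> M y" using M_inj cI y c by blast
      have "M (M y) = y" using MI y by blast
      \<comment> \<open>The special condition for \<open>c\<close> below \<open>M y\<close> gives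
        \<open>M c < y\<close>. As \<open>M a\<close> has the length of \<open>y\<close>,
        \<open>M a < M c\<close> is impossible, so the condition for \<open>a\<close> below
        \<open>c\<close> leaves only \<open>M a = c\<close>.\<close>
      have lMc: "len (M c) < len y"
        using special[of c "M y"] MI[OF y] cI c lc upy \<open>M c \<noteq> M y\<close> less_len by auto
      have "bruhat_less G S (M a) (M c)" if "M a \<noteq> c"
        using special[OF aI cI c(2)] that lc la xy by auto
      then have Ma: "M a = c" using lMa lMc less_len by fastforce
      obtain b where b: "b \<noteq> a" "up T (M x) b" "up T b c"
        using diamond[OF a(2) c(2)] la lc down xy by auto
      have bI: "b \<in> I" using convex[OF _ cI b(2,3)] MI x by blast
      \<comment> \<open>Any other atom below \<open>c\<close> would be matched with \<open>c\<close>
        by the argument used for \<open>a\<close>, against injectivity. Thus \<open>x\<close> lies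
        below \<open>c\<close>, which supplies the last edge of the crown.\<close>
      have "b = x"
      proof (rule ccontr)
        assume "b \<noteq> x"
        have lb: "len b = len x" using b(2,3) down(2) lc xy(2) by (simp add: up_def)
        have lMb: "len (M b) = len y" using atom[OF bI b(2) lb \<open>b \<noteq> x\<close>] lb xy by simp
        have "bruhat_less G S (M b) (M c)" if "M b \<noteq> c"
          using special[OF bI cI b(3)] that lc lb xy by auto
        then have "M b = c" using lMb lMc less_len by fastforce
        then show False using Ma M_inj aI bI b(1) by metis
      qed
      then show ?thesis
        using undirected_crown[of "M x" x a y c "M y"] a b c xy down upy up_adj carr MI x by metis
    qed
  qed

  have preserve: "adj (M x) (M y)" if "x \<in> I" "y \<in> I" "up T x y" for x y
    using that
  proof (induction "len y - len x" arbitrary: x y rule: less_induct)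
    case less
    note x = less.prems(1) and y = less.prems(2) and xy = less.prems(3)
    obtain t where t: "x \<in> carrier G" "t \<in> T" "y = x \<otimes> t" "len x < len y" using xy by (auto simp: up_def)
    show ?case
    proof (cases "len x + 3 \<le> len y")
      case True
      then obtain p q where "crown (plane p q) x y" using long_edge_crown t by blast
      then obtain a b c d where abcd: "a \<noteq> b" "c \<noteq> d"
        "up (plane p q) x a" "up (plane p q) x b" "up (plane p q) a c" "up (plane p q) a d"
        "up (plane p q) b c" "up (plane p q) b d" "up (plane p q) c y" "up (plane p q) d y"
        unfolding crown_def by blast
      have sub: "plane p q \<subseteq> T" using plane_T by blast
      note ups = abcd(3-10)[THEN up_mono, OF sub]
      have le: "le x a" "le x b" "le a c" "le a d" "le b c" "le b d" "le c y" "le d y"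
        using ups up_le by auto
      have inI: "a \<in> I" "b \<in> I" "c \<in> I" "d \<in> I"
        using x y le le_trans unfolding in_I by meson+
      have lens: "len x < len a" "len x < len b" "len a < len c" "len a < len d"
        "len b < len c" "len b < len d" "len c < len y" "len d < len y"
        using ups by (auto simp: up_def)
      have IH: "adj (M g) (M h)" if "g \<in> I" "h \<in> I" "up T g h" "len h - len g < len y - len x" for g h
        using less.hyps that by blast
      have "adj (M x) (M a)" "adj (M x) (M b)" "adj (M a) (M c)" "adj (M a) (M d)"
        "adj (M b) (M c)" "adj (M b) (M d)" "adj (M c) (M y)" "adj (M d) (M y)"
        using lens x y inI by (auto intro!: IH ups)
      moreover have "M a \<noteq> M b" "M c \<noteq> M d" using M_inj abcd(1,2) inI by blast+
      ultimately show ?thesis using undirected_crown carr MI(1) x by blast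
    next
      case False
      have "odd (len x + len y)"
        using even_len_mult[of x t] t T_carrier odd_len_T by auto
      then have "len y = len x + 1" using False t(4) by presburger
      then show ?thesis using short x y xy by blast
    qed
  qed
  have preserve': "adj (M x) (M y)" if x: "x \<in> I" and y: "y \<in> I" and xy: "adj x y" for x y
  proof (cases "len x < len y")
    case True
    then show ?thesis using preserve x y adj_up[OF xy carr[OF x]] by blast
  next
    case False
    then have "len y < len x" using adj_len_neq[OF xy carr[OF x]] by simp
    then have "adj (M y) (M x)" using preserve x y adj_up[OF adj_sym[OF xy]] carr by blast
    then show ?thesis using adj_sym carr MI y by blast
  qed
  have "bij_betw M I I"
    by (rule bij_betw_byWitness[where f' = M]) (use MI in auto)
  \<comment> \<open>The converse is preservation applied to \<open>M x\<close> and
    \<open>M y\<close>, as \<open>M\<close> is an involution.\<close>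
  moreover have "adj x y \<longleftrightarrow> adj (M x) (M y)" if "x \<in> I" "y \<in> I" for x y
    using preserve'[of x y] preserve'[of "M x" "M y"] MI that by auto
  ultimately show ?thesis unfolding gamma_automorphism_def I_def by blast
qed

end

theorem theorem6p3:
  assumes "coxeter_system G S"
    and "u \<in> carrier G" and "v \<in> carrier G"
    and "bruhat_le G S u v"
    and "special_matching G S u v M"
  shows "gamma_automorphism G S u v M"
proof -
  interpret coxeter G S
    using assms(1) by (intro coxeter.intro coxeter_axioms.intro) (simp_all add: coxeter_system_def)
  show ?thesis using special_matching_automorphism assms(5) .
qed

end
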